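(* For any $0<s_-<s_+\le1$, every pair $(H,D)$ of real numbers satisfying $$s_-\le H\le s_+,\qquad \frac{s_-s_+}{s_-+s_+-H}\le D\le H$$ is realised as $(H,D)=(h(\nu),D_0(\nu))$ by a Borel probability measure $\nu$ on $[0,1]$ whose dyadic local dimension $s(x)=\lim_{n\to\infty}\frac{-\log\nu(Q_n(x))}{n}$ exists and lies in $[s_-,s_+]$ for $\nu$-almost every $x$.
   Context: $\log$ is the logarithm to base 2 and $\ln$ the natural logarithm. $\mathcal D_n$ is the partition of $[0,1]$ into the $2^n$ half-open dyadic intervals of length $2^{-n}$ (the point $1$ being assigned to the last interval), and $Q_n(x)$ is the interval of $\mathcal D_n$ containing $x$. $h(\nu)=\lim_{k\to\infty}-\frac1k\sum_{Q\in\mathcal D_k}\nu(Q)\log\nu(Q)$ and $D_0(\nu)=\lim_{N\to\infty}\frac{\log N}{-\log\mathfrak e_{N,0}(\nu)}$, where $\mathfrak e_{N,0}(\nu)=\inf_{1\le\#A\le N}\exp\bigl(\int\ln d(x,A)\,d\nu(x)\bigr)$, infimum over non-empty finite $A\subset\mathbb{R}$, $d(x,A)=\inf_{y\in A}|x-y|$; realisation includes the existence of both limits. *)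

theory Defs
  imports "HOL-Analysis.Analysis" "HOL-Probability.Probability"
begin

(* The last interval of each generation is closed, so that it contains the point 1. *)
definition dyadic_interval :: "nat \<Rightarrow> nat \<Rightarrow> real set" where
  "dyadic_interval n k =
     (if k + 1 < 2 ^ n then {real k / 2 ^ n ..< real (k + 1) / 2 ^ n}
      else {real k / 2 ^ n .. real (k + 1) / 2 ^ n})"

definition dyadic_partition :: "nat \<Rightarrow> real set set" where
  "dyadic_partition n = dyadic_interval n ` {..<2 ^ n}"

definition dyadic_containing :: "nat \<Rightarrow> real \<Rightarrow> real set" where
  "dyadic_containing n x = (THE Q. Q \<in> dyadic_partition n \<and> x \<in> Q)"

(* Since log 2 0 = 0 in HOL, the convention 0 log 0 = 0 is built in. *)
definition dyadic_entropy :: "real measure \<Rightarrow> nat \<Rightarrow> real" where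
  "dyadic_entropy \<nu> k =
     - (\<Sum>Q\<in>dyadic_partition k. measure \<nu> Q * log 2 (measure \<nu> Q))"

definition has_entropy_dimension :: "real measure \<Rightarrow> real \<Rightarrow> bool" where
  "has_entropy_dimension \<nu> h \<longleftrightarrow> (\<lambda>k. dyadic_entropy \<nu> k / real k) \<longlonglongrightarrow> h"

(* If measure \<nu> (dyadic_containing n x) = 0 for large n, the sequence below is eventually 0
   in HOL (not infinite). The set of such x in [0,1] is a countable union of \<nu>-null dyadic
   intervals, hence \<nu>-null. *)
definition has_dyadic_local_dimension :: "real measure \<Rightarrow> real \<Rightarrow> real \<Rightarrow> bool" where
  "has_dyadic_local_dimension \<nu> x s \<longleftrightarrow>
     (\<lambda>n. - log 2 (measure \<nu> (dyadic_containing n x)) / real n) \<longlonglongrightarrow> s"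

(* Extended logarithm and exponential: ln 0 = -\<infinity>, exp (-\<infinity>) = 0. The real-valued ln has
   ln 0 = 0, which would make atoms of the measure invisible to the integral below. *)
definition ext_ln :: "ereal \<Rightarrow> ereal" where
  "ext_ln x = (if x \<le> 0 then -\<infinity> else if x = \<infinity> then \<infinity> else ereal (ln (real_of_ereal x)))"

definition ext_log2 :: "ereal \<Rightarrow> ereal" where
  "ext_log2 x = ext_ln x / ereal (ln 2)"

definition ext_exp :: "ereal \<Rightarrow> ereal" where
  "ext_exp x = (if x = -\<infinity> then 0 else if x = \<infinity> then \<infinity> else ereal (exp (real_of_ereal x)))"

(* Integral of an extended-real function as positive minus negative part (e2ennreal maps
   negative values to 0). Meaningful whenever one of the two parts is finite; below, d(x,A) is
   bounded in x on [0,1], so the positive part is finite and the value may be -\<infinity>. *)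
definition ext_integral :: "'a measure \<Rightarrow> ('a \<Rightarrow> ereal) \<Rightarrow> ereal" where
  "ext_integral M f =
     enn2ereal (\<integral>\<^sup>+ x. e2ennreal (f x) \<partial>M) - enn2ereal (\<integral>\<^sup>+ x. e2ennreal (- f x) \<partial>M)"

(* Optimal quantization error of order 0 (geometric mean error) with at most N points. *)
definition geom_quantization_error :: "real measure \<Rightarrow> nat \<Rightarrow> ereal" where
  "geom_quantization_error \<nu> N =
     (INF A \<in> {A :: real set. finite A \<and> 1 \<le> card A \<and> card A \<le> N}.
        ext_exp (ext_integral \<nu> (\<lambda>x. ext_ln (ereal (infdist x A)))))"

definition has_geom_quantization_dimension :: "real measure \<Rightarrow> real \<Rightarrow> bool" where
  "has_geom_quantization_dimension \<nu> D \<longleftrightarrow>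
     (\<lambda>N. ereal (log 2 (real N)) / (- ext_log2 (geom_quantization_error \<nu> N)))
       \<longlonglongrightarrow> ereal D"

end

theory Submission
  imports Defs "HOL-Real_Asymp.Real_Asymp"
begin

text \<open>
  A Cantor measure of dimension \<open>s\<close> is obtained from Lebesgue measure by inserting zeros into the
  binary expansion, so that exactly \<open>\<lfloor>s n\<rfloor>\<close> of the first \<open>n\<close> digits are free. Every dyadic interval
  of generation \<open>n\<close> then has mass \<open>0\<close> or exactly \<open>2 ^ (- \<lfloor>s n\<rfloor>)\<close>. A mixture of two such measures, of
  dimensions \<open>s1 \<le> s2\<close> and weights \<open>p\<close> and \<open>1 - p\<close>, has local dimensions \<open>s1\<close> and \<open>s2\<close>. Its entropy
  dimension is the weighted arithmetic mean of \<open>s1\<close> and \<open>s2\<close>, because mixing changes the entropy only by a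
  bounded amount. Its geometric quantization dimension is their weighted harmonic mean: \<open>N / 2\<close> points
  suffice to resolve one component of dimension \<open>s\<close> down to scale \<open>N powr (- 1 / s)\<close>, and \<open>N\<close> points
  cannot do better up to a constant factor. Keeping the arithmetic mean \<open>H\<close> and the weights fixed
  while moving \<open>s1\<close> and \<open>s2\<close> from \<open>H\<close> to the end points, the harmonic mean passes through all
  admissible values of \<open>D\<close>.
\<close>

section \<open>Dyadic intervals\<close>

text \<open>On \<open>{0..1}\<close> the cap \<open>2 ^ n - 1\<close> takes effect only at
  \<open>x = 1\<close>, which thereby falls into the closed last interval.\<close>

definition dyadic_index :: "nat \<Rightarrow> real \<Rightarrow> nat" where
  "dyadic_index n x = min (nat \<lfloor>2 ^ n * x\<rfloor>) (2 ^ n - 1)"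

lemma dyadic_index_less: "dyadic_index n x < 2 ^ n"
  by (simp add: dyadic_index_def min_less_iff_disj)

lemma nat_floor_eq_iff:
  fixes y :: real
  assumes "0 \<le> y"
  shows "nat \<lfloor>y\<rfloor> = k \<longleftrightarrow> real k \<le> y \<and> y < real k + 1"
  using assms by (simp add: nat_eq_iff floor_eq_iff)

lemma mem_dyadic_interval_iff:
  assumes "x \<in> {0..1}" "k < 2 ^ n"
  shows "x \<in> dyadic_interval n k \<longleftrightarrow> dyadic_index n x = k"
proof (cases "k + 1 < 2 ^ n")
  case True
  have "x \<in> dyadic_interval n k \<longleftrightarrow> real k \<le> 2 ^ n * x \<and> 2 ^ n * x < real k + 1"
    using True by (simp add: dyadic_interval_def field_simps)
  also have "\<dots> \<longleftrightarrow> nat \<lfloor>2 ^ n * x\<rfloor> = k"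
    using assms by (subst nat_floor_eq_iff) auto
  also have "\<dots> \<longleftrightarrow> dyadic_index n x = k"
    using True by (auto simp: dyadic_index_def min_def)
  finally show ?thesis .
next
  case False
  hence k: "2 ^ n = k + 1" using assms(2) by simp
  hence k': "2 ^ n = real k + 1" by (metis of_nat_1 of_nat_add of_nat_numeral of_nat_power)
  have "x \<in> dyadic_interval n k \<longleftrightarrow> real k \<le> 2 ^ n * x"
    using False assms by (simp add: dyadic_interval_def k' field_simps)
  also have "\<dots> \<longleftrightarrow> k \<le> nat \<lfloor>2 ^ n * x\<rfloor>"
    using assms by (simp add: le_nat_iff le_floor_iff)
  also have "\<dots> \<longleftrightarrow> dyadic_index n x = k"
    using k by (auto simp: dyadic_index_def min_def)
  finally show ?thesis .
qed

lemma dyadic_interval_subset: "k < 2 ^ n \<Longrightarrow> dyadic_interval n k \<subseteq> {0..1}"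
proof
  fix x assume k: "k < 2 ^ n" and x: "x \<in> dyadic_interval n k"
  have "real (k + 1) \<le> 2 ^ n"
    using k by (metis Suc_eq_plus1 Suc_leI of_nat_le_iff of_nat_numeral of_nat_power)
  hence u: "real (k + 1) / 2 ^ n \<le> 1" by simp
  have l: "0 \<le> real k / 2 ^ n" by simp
  have "real k / 2 ^ n \<le> x" "x \<le> real (k + 1) / 2 ^ n"
    using x by (auto simp: dyadic_interval_def split: if_splits)
  from order_trans[OF l this(1)] order_trans[OF this(2) u] show "x \<in> {0..1}" by simp
qed

lemma dyadic_interval_eq:
  "k < 2 ^ n \<Longrightarrow> dyadic_interval n k = {x \<in> {0..1}. dyadic_index n x = k}"
  using mem_dyadic_interval_iff dyadic_interval_subset by blast

lemma left_endpoint_mem: "real k / 2 ^ n \<in> dyadic_interval n k"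
  by (simp add: dyadic_interval_def field_simps)

lemma inj_on_dyadic_interval: "inj_on (dyadic_interval n) {..<2 ^ n}"
proof (rule inj_onI)
  fix k l :: nat assume kl: "k \<in> {..<2 ^ n}" "l \<in> {..<2 ^ n}" "dyadic_interval n k = dyadic_interval n l"
  have "real k / 2 ^ n \<in> dyadic_interval n l" using left_endpoint_mem kl by metis
  hence "dyadic_index n (real k / 2 ^ n) = l" using kl by (simp add: dyadic_interval_eq)
  moreover have "dyadic_index n (real k / 2 ^ n) = k"
    using left_endpoint_mem[of k n] kl(1) by (simp add: dyadic_interval_eq)
  ultimately show "k = l" by simp
qed

lemma dyadic_containing_eq:
  assumes "x \<in> {0..1}"
  shows "dyadic_containing n x = dyadic_interval n (dyadic_index n x)"
  unfolding dyadic_containing_def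
  by (rule the_equality) (use assms dyadic_index_less in \<open>auto simp: dyadic_partition_def mem_dyadic_interval_iff\<close>)

lemma dyadic_containing_in_partition:
  "x \<in> {0..1} \<Longrightarrow> dyadic_containing n x \<in> dyadic_partition n"
  by (simp add: dyadic_containing_eq dyadic_partition_def dyadic_index_less)

lemma mem_dyadic_containing: "x \<in> {0..1} \<Longrightarrow> x \<in> dyadic_containing n x"
  by (simp add: dyadic_containing_eq mem_dyadic_interval_iff dyadic_index_less)

text \<open>Halving drops the last binary digit. The nesting of dyadic intervals and the digit
  recursion of the Cantor measures both rest on this.\<close>

lemma nat_floor_double_div_2:
  fixes y :: real
  assumes "0 \<le> y"
  shows "nat \<lfloor>2 * y\<rfloor> div 2 = nat \<lfloor>y\<rfloor>"
proof -
  have "\<lfloor>2 * y / real_of_int 2\<rfloor> = \<lfloor>2 * y\<rfloor> div 2"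
    by (rule floor_divide_real_eq_div) simp
  thus ?thesis using assms by (simp add: nat_div_distrib)
qed

lemma dyadic_index_Suc:
  assumes "0 \<le> x"
  shows "dyadic_index n x = dyadic_index (Suc n) x div 2"
proof -
  have "dyadic_index (Suc n) x div 2 = min (nat \<lfloor>2 ^ Suc n * x\<rfloor> div 2) ((2 ^ Suc n - 1) div 2)"
    unfolding dyadic_index_def by (rule min_of_mono[symmetric]) (auto intro!: monoI div_le_mono)
  also have "nat \<lfloor>2 ^ Suc n * x\<rfloor> div 2 = nat \<lfloor>2 ^ n * x\<rfloor>"
    using nat_floor_double_div_2[of "2 ^ n * x"] assms by (simp add: mult.assoc)
  also have "(2 ^ Suc n - 1) div 2 = (2 ^ n - 1 :: nat)"
    by (cases "2 ^ n :: nat") simp_all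
  finally show ?thesis by (simp add: dyadic_index_def)
qed

lemma dyadic_containing_antimono:
  assumes "x \<in> {0..1}" "m \<le> n"
  shows "dyadic_containing n x \<subseteq> dyadic_containing m x"
  using assms(2)
proof (induction rule: dec_induct)
  case (step n)
  have "dyadic_index n y = dyadic_index n x"
    if "0 \<le> y" "dyadic_index (Suc n) y = dyadic_index (Suc n) x" for y
    using assms(1) that dyadic_index_Suc[of x n] dyadic_index_Suc[of y n] by simp
  hence "dyadic_containing (Suc n) x \<subseteq> dyadic_containing n x"
    unfolding dyadic_containing_eq[OF assms(1)] dyadic_interval_eq[OF dyadic_index_less] by fastforce
  with step.IH show ?case by blast
qed simp

lemma dyadic_interval_sets:
  assumes "k < 2 ^ n"
  shows "dyadic_interval n k \<in> sets (restrict_space borel {0..1})"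
proof -
  have "dyadic_interval n k \<in> sets borel" by (simp add: dyadic_interval_def)
  thus ?thesis using dyadic_interval_subset[OF assms] by (simp add: sets_restrict_space_iff)
qed

section \<open>Equidistributed Cantor measures\<close>

text \<open>Collects the facts shared by the two components and their mixture.\<close>

locale unit_interval_prob = prob_space \<mu> for \<mu> :: "real measure" +
  assumes sets_eq: "sets \<mu> = sets (restrict_space borel {0..1})"
begin

lemma space_eq: "space \<mu> = {0..1}"
  using sets_eq_imp_space_eq[OF sets_eq] by (simp add: space_restrict_space)

lemma dyadic_partition_sets: "Q \<in> dyadic_partition n \<Longrightarrow> Q \<in> sets \<mu>"
  by (auto simp: dyadic_partition_def sets_eq dyadic_interval_sets)

lemma sum_dyadic_mass: "(\<Sum>Q\<in>dyadic_partition n. prob Q) = 1"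
proof -
  have "(\<Sum>Q\<in>dyadic_partition n. prob Q) = (\<Sum>k<2 ^ n. prob (dyadic_interval n k))"
    unfolding dyadic_partition_def by (rule sum.reindex_cong[OF inj_on_dyadic_interval]) auto
  also have "\<dots> = prob (\<Union>k\<in>{..<2 ^ n}. dyadic_interval n k)"
  proof (rule finite_measure_finite_Union[symmetric])
    show "disjoint_family_on (dyadic_interval n) {..<2 ^ n}"
      by (auto simp: disjoint_family_on_def dyadic_interval_eq)
  qed (auto simp: sets_eq dyadic_interval_sets)
  also have "(\<Union>k\<in>{..<2 ^ n}. dyadic_interval n k) = space \<mu>"
    by (auto simp: space_eq dyadic_interval_eq dyadic_index_less)
  finally show ?thesis by (simp add: prob_space)
qed

text \<open>Each generation has finitely many null intervals and there are countably many
  generations, so the points lying in some null dyadic interval form a null set.\<close>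

lemma AE_dyadic_mass_pos: "AE x in \<mu>. \<forall>n. 0 < prob (dyadic_containing n x)"
proof -
  have "AE x in \<mu>. \<forall>n. \<forall>Q\<in>{Q \<in> dyadic_partition n. prob Q = 0}. x \<notin> Q"
  proof (subst AE_all_countable, rule allI, rule AE_finite_allI)
    fix n Q assume "Q \<in> {Q \<in> dyadic_partition n. prob Q = 0}"
    hence "Q \<in> null_sets \<mu>"
      using dyadic_partition_sets by (auto simp: null_sets_def emeasure_eq_measure)
    thus "AE x in \<mu>. x \<notin> Q" by (rule AE_not_in)
  qed (simp add: dyadic_partition_def)
  with AE_space show ?thesis
  proof eventually_elim
    case (elim x)
    hence x: "x \<in> {0..1}" by (simp add: space_eq)
    show ?case
    proof
      fix n
      have "prob (dyadic_containing n x) \<noteq> 0"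
        using elim(2) dyadic_containing_in_partition[OF x, of n] mem_dyadic_containing[OF x, of n]
        by blast
      thus "0 < prob (dyadic_containing n x)" by (simp add: zero_less_measure_iff)
    qed
  qed
qed

end

text \<open>All later estimates for a component use only this dichotomy of masses, never the way the
  measure was constructed.\<close>

locale equidistributed = unit_interval_prob +
  fixes S :: "nat \<Rightarrow> nat"
  assumes dyadic_mass: "Q \<in> dyadic_partition n \<Longrightarrow> prob Q \<in> {0, (1 / 2) ^ S n}"

text \<open>\<open>spread S n m\<close> distributes the \<open>S n\<close> binary digits of \<open>m\<close> over the positions below \<open>n\<close>
  at which \<open>S\<close> increases and writes zeros elsewhere.\<close>

primrec spread :: "(nat \<Rightarrow> nat) \<Rightarrow> nat \<Rightarrow> nat \<Rightarrow> nat" where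
  "spread S 0 m = 0"
| "spread S (Suc n) m =
     (if S (Suc n) = S n then 2 * spread S n m else 2 * spread S n (m div 2) + m mod 2)"

section \<open>Distributing binary digits over prescribed positions\<close>

locale digit_positions =
  fixes S :: "nat \<Rightarrow> nat"
  assumes S_0: "S 0 = 0" and S_Suc: "S (Suc n) = S n \<or> S (Suc n) = Suc (S n)"
begin

lemma spread_less: "m < 2 ^ S n \<Longrightarrow> spread S n m < 2 ^ n"
proof (induction n arbitrary: m)
  case (Suc n)
  show ?case
  proof (cases "S (Suc n) = S n")
    case True
    with Suc.IH[of m] Suc.prems show ?thesis by simp
  next
    case False
    hence "m div 2 < 2 ^ S n" using Suc.prems S_Suc[of n] by auto
    from Suc.IH[OF this] False show ?thesis by simp
  qed
qed simp

text \<open>At a free position the parity of the code gives the last digit of \<open>m\<close>, and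
  the rest is the code of \<open>m div 2\<close>; so \<open>m\<close> can be read off digit by
  digit.\<close>

lemma inj_on_spread: "inj_on (spread S n) {..<2 ^ S n}"
proof (induction n)
  case 0
  then show ?case by (simp add: S_0 inj_on_def)
next
  case (Suc n)
  show ?case
  proof (cases "S (Suc n) = S n")
    case True
    with Suc show ?thesis by (auto simp: inj_on_def)
  next
    case False
    show ?thesis
    proof (rule inj_onI)
      fix l m assume lm: "l \<in> {..<2 ^ S (Suc n)}" "m \<in> {..<2 ^ S (Suc n)}"
        "spread S (Suc n) l = spread S (Suc n) m"
      have "2 * spread S n (l div 2) + l mod 2 = 2 * spread S n (m div 2) + m mod 2"
        using lm(3) False by simp
      hence "spread S n (l div 2) = spread S n (m div 2)" and "l mod 2 = m mod 2"
        by presburger+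
      moreover have "l div 2 \<in> {..<2 ^ S n}" "m div 2 \<in> {..<2 ^ S n}"
        using lm(1,2) S_Suc[of n] False by auto
      ultimately have "l div 2 = m div 2" "l mod 2 = m mod 2" using Suc by (auto dest: inj_onD)
      thus "l = m" by (metis div_mult_mod_eq)
    qed
  qed
qed

text \<open>For \<open>x\<close> in \<open>{0..<1}\<close> this is the integer formed by the first
  \<open>n\<close> binary digits of the image of \<open>x\<close>: the first \<open>S n\<close>
  digits of \<open>x\<close>, moved to the free positions.\<close>

definition digit_code :: "nat \<Rightarrow> real \<Rightarrow> nat" where
  "digit_code n x = spread S n (nat \<lfloor>2 ^ S n * x\<rfloor>)"

lemma digit_code_Suc:
  assumes "0 \<le> x"
  shows "digit_code (Suc n) x =
    2 * digit_code n x + (if S (Suc n) = S n then 0 else nat \<lfloor>2 ^ S (Suc n) * x\<rfloor> mod 2)"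
proof (cases "S (Suc n) = S n")
  case False
  hence "S (Suc n) = Suc (S n)" using S_Suc by blast
  moreover have "nat \<lfloor>2 * (2 ^ S n * x)\<rfloor> div 2 = nat \<lfloor>2 ^ S n * x\<rfloor>"
    using assms by (intro nat_floor_double_div_2) simp
  ultimately show ?thesis by (simp add: digit_code_def mult.assoc)
qed (simp add: digit_code_def)

text \<open>The binary expansion chosen by \<open>floor\<close> never ends in ones only.\<close>

lemma digit_code_doubles_infinitely_often:
  assumes "0 \<le> x"
  shows "\<exists>m\<ge>n. digit_code (Suc m) x = 2 * digit_code m x"
proof (rule ccontr)
  assume "\<not> ?thesis"
  hence ne: "digit_code (Suc m) x \<noteq> 2 * digit_code m x" if "m \<ge> n" for m using that by blast
  define q where "q m = nat \<lfloor>2 ^ S m * x\<rfloor>" for m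
  have S: "S (Suc m) = Suc (S m)" and q: "q (Suc m) = 2 * q m + 1" if "m \<ge> n" for m
  proof -
    show *: "S (Suc m) = Suc (S m)"
      using ne[OF that] digit_code_Suc[OF assms, of m] S_Suc[of m] by auto
    have "q (Suc m) mod 2 = 1"
      using ne[OF that] digit_code_Suc[OF assms, of m] * unfolding q_def
      by (metis add_0_right not_mod_2_eq_1_eq_0 n_not_Suc_n)
    moreover have "q (Suc m) div 2 = q m"
      using nat_floor_double_div_2[of "2 ^ S m * x"] assms * by (simp add: q_def mult.assoc)
    ultimately show "q (Suc m) = 2 * q m + 1" by presburger
  qed
  \<comment> \<open>From generation \<open>n\<close> on all appended digits are ones, so the right
    end \<open>(q m + 1) / 2 ^ S m\<close> of the interval around \<open>x\<close> never
    moves.\<close>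
  have eq: "S (n + j) = S n + j \<and> real (q (n + j)) + 1 = 2 ^ j * (real (q n) + 1)" for j
    by (induction j) (simp_all add: S q)
  have le: "real (q m) \<le> 2 ^ S m * x" "2 ^ S m * x < real (q m) + 1" for m
    using nat_floor_eq_iff[of "2 ^ S m * x" "q m"] assms by (auto simp: q_def)
  \<comment> \<open>The gap between \<open>x\<close> and that right end, in units of
    \<open>(1 / 2) ^ S n\<close>. It is positive by the choice of the floor, yet at most
    \<open>(1 / 2) ^ j\<close> for every \<open>j\<close>.\<close>
  define d where "d = real (q n) + 1 - 2 ^ S n * x"
  have "d > 0" using le(2)[of n] by (simp add: d_def)
  then obtain j where "(1 / 2) ^ j < d" using real_arch_pow_inv[of d "1/2"] by auto
  moreover have "2 ^ j * d \<le> 1"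
    using le(1)[of "n + j"] eq[of j] by (simp add: d_def algebra_simps power_add)
  ultimately show False by (simp add: field_simps power_divide)
qed

text \<open>For \<open>0 \<le> x\<close> the truncations increase with \<open>n\<close>, so the
  supremum is the value of the full expansion; being a countable supremum makes it
  measurable.\<close>

definition spread_real :: "real \<Rightarrow> real" where
  "spread_real x = (SUP n. real (digit_code n x) / 2 ^ n)"

text \<open>Appending a digit passes to one half of the current interval, so right ends decrease;
  the next lemma is the counterpart for left ends.\<close>

lemma digit_code_upper_decreasing:
  assumes "0 \<le> x" "m \<le> n"
  shows "(real (digit_code n x) + 1) / 2 ^ n \<le> (real (digit_code m x) + 1) / 2 ^ m"
  using assms(2)
proof (induction rule: dec_induct)
  case (step n)
  have "digit_code (Suc n) x + 1 \<le> 2 * (digit_code n x + 1)"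
    by (auto simp: digit_code_Suc[OF assms(1)])
  hence "real (digit_code (Suc n) x + 1) \<le> real (2 * (digit_code n x + 1))" by (subst of_nat_le_iff)
  hence "real (digit_code (Suc n) x) + 1 \<le> 2 * (real (digit_code n x) + 1)" by simp
  from divide_right_mono[OF this, of "2 ^ Suc n"]
  have "(real (digit_code (Suc n) x) + 1) / 2 ^ Suc n \<le> 2 * (real (digit_code n x) + 1) / 2 ^ Suc n"
    by simp
  also have "\<dots> = (real (digit_code n x) + 1) / 2 ^ n"
    by (simp add: field_simps)
  finally have "(real (digit_code (Suc n) x) + 1) / 2 ^ Suc n \<le> (real (digit_code n x) + 1) / 2 ^ n" .
  with step show ?case by linarith
qed simp

lemma digit_code_lower_increasing:
  assumes "0 \<le> x" "m \<le> n"
  shows "real (digit_code m x) / 2 ^ m \<le> real (digit_code n x) / 2 ^ n"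
  using assms(2)
proof (induction rule: dec_induct)
  case (step n)
  have "2 * digit_code n x \<le> digit_code (Suc n) x"
    by (auto simp: digit_code_Suc[OF assms(1)])
  hence "real (2 * digit_code n x) \<le> real (digit_code (Suc n) x)" by (subst of_nat_le_iff)
  hence "real (digit_code n x) / 2 ^ n \<le> real (digit_code (Suc n) x) / 2 ^ Suc n"
    by (simp add: field_simps)
  with step show ?case by linarith
qed simp

lemma digit_code_lower_le_upper:
  assumes "0 \<le> x"
  shows "real (digit_code m x) / 2 ^ m \<le> (real (digit_code n x) + 1) / 2 ^ n"
proof -
  have "real (digit_code m x) / 2 ^ m \<le> real (digit_code (max m n) x) / 2 ^ max m n"
    using assms by (intro digit_code_lower_increasing) auto
  also have "\<dots> \<le> (real (digit_code (max m n) x) + 1) / 2 ^ max m n" by (simp add: field_simps)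
  also have "\<dots> \<le> (real (digit_code n x) + 1) / 2 ^ n"
    using assms by (intro digit_code_upper_decreasing) auto
  finally show ?thesis .
qed

lemma bdd_above_digit_code: "0 \<le> x \<Longrightarrow> bdd_above (range (\<lambda>n. real (digit_code n x) / 2 ^ n))"
  using digit_code_lower_le_upper[of x _ 0] by (intro bdd_aboveI2)

text \<open>The strictness of the upper bound matters: it keeps the image out of the neighbouring
  half-open interval. It holds because at some later position the digit is zero, and there the right
  end moves strictly inwards.\<close>

lemma spread_real_bounds:
  assumes "0 \<le> x"
  shows "real (digit_code n x) / 2 ^ n \<le> spread_real x" "spread_real x < (real (digit_code n x) + 1) / 2 ^ n"
proof -
  show "real (digit_code n x) / 2 ^ n \<le> spread_real x"
    unfolding spread_real_def by (intro cSUP_upper bdd_above_digit_code assms) simp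
  obtain m where m: "m \<ge> n" "digit_code (Suc m) x = 2 * digit_code m x"
    using digit_code_doubles_infinitely_often[OF assms] by blast
  have "spread_real x \<le> (real (digit_code (Suc m) x) + 1) / 2 ^ Suc m"
    unfolding spread_real_def by (intro cSUP_least digit_code_lower_le_upper assms) simp
  also have "\<dots> < (real (digit_code m x) + 1) / 2 ^ m" by (simp add: m(2) field_simps)
  also have "\<dots> \<le> (real (digit_code n x) + 1) / 2 ^ n" using assms m by (intro digit_code_upper_decreasing)
  finally show "spread_real x < (real (digit_code n x) + 1) / 2 ^ n" .
qed

section \<open>Push-forward of Lebesgue measure under the digit map\<close>

lemma nat_floor_less_power: "x \<in> {0..<1} \<Longrightarrow> nat \<lfloor>2 ^ j * x\<rfloor> < 2 ^ j"
  for x :: real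
proof -
  assume x: "x \<in> {0..<1}"
  hence "2 ^ j * x < 2 ^ j" by simp
  hence "\<lfloor>2 ^ j * x\<rfloor> < 2 ^ j" by (simp add: floor_less_iff)
  thus ?thesis by (simp add: nat_less_iff)
qed

lemma digit_code_less: "x \<in> {0..<1} \<Longrightarrow> digit_code n x < 2 ^ n"
  unfolding digit_code_def by (intro spread_less nat_floor_less_power)

lemma spread_real_in_interval: "x \<in> {0..<1} \<Longrightarrow> spread_real x \<in> {0..1}"
  using spread_real_bounds[of x 0] digit_code_less[of x 0] by simp

lemma dyadic_index_spread_real:
  assumes "x \<in> {0..<1}"
  shows "dyadic_index n (spread_real x) = digit_code n x"
proof -
  have "nat \<lfloor>2 ^ n * spread_real x\<rfloor> = digit_code n x"
    using spread_real_bounds[of x n] spread_real_in_interval[OF assms] assms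
    by (subst nat_floor_eq_iff) (auto simp: field_simps)
  thus ?thesis using digit_code_less[OF assms, of n] by (simp add: dyadic_index_def)
qed

lemma digit_code_measurable [measurable]: "(\<lambda>x. real (digit_code n x)) \<in> borel_measurable borel"
  unfolding digit_code_def by measurable

lemma spread_real_measurable:
  "spread_real \<in> measurable (restrict_space lborel {0..<1}) (restrict_space borel {0..1})"
proof (rule measurable_restrict_space2)
  show "spread_real \<in> space (restrict_space lborel {0..<1}) \<rightarrow> {0..1}"
    using spread_real_in_interval by (auto simp: space_restrict_space)
  have "(\<lambda>x. SUP n. real (digit_code n x) / 2 ^ n) \<in> borel_measurable (restrict_space lborel {0..<1})"
    by (intro borel_measurable_cSUP bdd_above_digit_code measurable_restrict_space1)
       (auto simp: space_restrict_space)
  thus "spread_real \<in> borel_measurable (restrict_space lborel {0..<1})"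
    by (simp add: spread_real_def[abs_def])
qed

text \<open>The measure is the push-forward of Lebesgue measure on \<open>{0..<1}\<close> under
  \<open>spread_real\<close>. Lying in a given dyadic interval of generation \<open>n\<close>
  prescribes the first \<open>S n\<close> digits of \<open>x\<close>: by injectivity of
  \<open>spread\<close> the preimage is empty or a single interval of length
  \<open>(1 / 2) ^ S n\<close>.\<close>

lemma exists_equidistributed: "\<exists>\<mu>. equidistributed \<mu> S"
proof -
  define M where "M = restrict_space lborel {0..<1::real}"
  have space_M: "space M = {0..<1}" by (simp add: M_def space_restrict_space)
  interpret M: prob_space M
    by (rule prob_spaceI) (simp add: M_def emeasure_restrict_space space_restrict_space)
  have meas: "spread_real \<in> measurable M (restrict_space borel {0..1})"
    using spread_real_measurable by (simp add: M_def)
  define \<mu> where "\<mu> = distr M (restrict_space borel {0..1}) spread_real"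
  interpret prob_space \<mu> unfolding \<mu>_def by (rule M.prob_space_distr[OF meas])
  have "prob Q \<in> {0, (1 / 2) ^ S n}" if Q: "Q \<in> dyadic_partition n" for Q n
  proof -
    obtain k where k: "k < 2 ^ n" "Q = dyadic_interval n k"
      using Q by (auto simp: dyadic_partition_def)
    have "prob Q = M.prob (spread_real -` Q \<inter> space M)"
      unfolding \<mu>_def k(2) by (intro measure_distr meas dyadic_interval_sets k)
    also have "spread_real -` Q \<inter> space M = {x \<in> {0..<1}. digit_code n x = k}"
      using k by (auto simp: space_M mem_dyadic_interval_iff[OF spread_real_in_interval]
        dyadic_index_spread_real)
    also have "M.prob \<dots> \<in> {0, (1 / 2) ^ S n}"
    proof (cases "\<exists>m<2 ^ S n. spread S n m = k")
      case False
      hence *: "{x \<in> {0..<1}. digit_code n x = k} = {}"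
        using nat_floor_less_power unfolding digit_code_def by blast
      show ?thesis unfolding * by simp
    next
      case True
      then obtain m where m: "m < 2 ^ S n" "spread S n m = k" by blast
      have "digit_code n x = k \<longleftrightarrow> nat \<lfloor>2 ^ S n * x\<rfloor> = m" if "x \<in> {0..<1}" for x
        using inj_on_eq_iff[OF inj_on_spread, of "nat \<lfloor>2 ^ S n * x\<rfloor>" n m]
          nat_floor_less_power[OF that] m by (simp add: digit_code_def)
      hence "{x \<in> {0..<1}. digit_code n x = k} =
          {x \<in> {0..<1}. real m / 2 ^ S n \<le> x \<and> x < (real m + 1) / 2 ^ S n}"
        by (auto simp: nat_floor_eq_iff field_simps)
      also have "\<dots> = {real m / 2 ^ S n ..< (real m + 1) / 2 ^ S n}"
      proof -
        have "real m + 1 \<le> 2 ^ S n"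
          using m(1) by (metis Suc_leI of_nat_Suc of_nat_le_iff of_nat_numeral of_nat_power add.commute)
        hence u: "(real m + 1) / 2 ^ S n \<le> 1" by simp
        have l: "0 \<le> real m / 2 ^ S n" by simp
        from order_trans[OF l] less_le_trans[OF _ u] show ?thesis by auto
      qed
      finally have *: "{x \<in> {0..<1}. digit_code n x = k} = \<dots>" .
      have "M.prob {x \<in> {0..<1}. digit_code n x = k} = measure lborel {x \<in> {0..<1}. digit_code n x = k}"
        unfolding M_def by (intro measure_restrict_space) auto
      also have "\<dots> = (1 / 2) ^ S n"
        unfolding * by (simp add: field_simps power_divide)
      finally show ?thesis by simp
    qed
    finally show ?thesis .
  qed
  hence "equidistributed \<mu> S"
    by unfold_locales (simp_all add: \<mu>_def)
  thus ?thesis ..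
qed

end

section \<open>Digit counts growing at rate \<open>s\<close>\<close>

definition linear_growth :: "real \<Rightarrow> nat \<Rightarrow> nat" where
  "linear_growth s n = nat \<lfloor>s * real n\<rfloor>"

lemma linear_growth_bounds:
  assumes "0 \<le> s"
  shows "real (linear_growth s n) \<le> s * real n" "s * real n < real (linear_growth s n) + 1"
  using nat_floor_eq_iff[of "s * real n" "linear_growth s n"] assms
  by (auto simp: linear_growth_def)

text \<open>Adding \<open>s \<le> 1\<close> raises the floor by at most one.\<close>

lemma digit_positions_linear_growth:
  assumes "0 \<le> s" "s \<le> 1"
  shows "digit_positions (linear_growth s)"
proof
  show "linear_growth s 0 = 0" by (simp add: linear_growth_def)
  fix n
  have *: "s * real n \<le> s * real (Suc n)" "s * real (Suc n) \<le> s * real n + 1"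
    using assms by (simp_all add: algebra_simps)
  have "real (linear_growth s n) < real (linear_growth s (Suc n)) + 1"
    "real (linear_growth s (Suc n)) < real (linear_growth s n) + 2"
    using linear_growth_bounds[OF assms(1), of n] linear_growth_bounds[OF assms(1), of "Suc n"] *
    by linarith+
  thus "linear_growth s (Suc n) = linear_growth s n \<or> linear_growth s (Suc n) = Suc (linear_growth s n)"
    by linarith
qed

lemma linear_growth_limit:
  assumes "0 \<le> s"
  shows "(\<lambda>n. real (linear_growth s n) / real n) \<longlonglongrightarrow> s"
proof (rule tendsto_sandwich)
  show "\<forall>\<^sub>F n in sequentially. s - 1 / real n \<le> real (linear_growth s n) / real n"
    using eventually_gt_at_top[of 0]
  proof eventually_elim
    case (elim n)
    have "s = (s * real n) / real n" using elim by simp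
    also have "\<dots> \<le> (real (linear_growth s n) + 1) / real n"
      using linear_growth_bounds(2)[OF assms, of n] by (intro divide_right_mono) auto
    finally show ?case by (simp add: add_divide_distrib)
  qed
  show "\<forall>\<^sub>F n in sequentially. real (linear_growth s n) / real n \<le> s"
    using eventually_gt_at_top[of 0]
  proof eventually_elim
    case (elim n)
    with linear_growth_bounds(1)[OF assms, of n] show ?case by (simp add: field_simps)
  qed
  have "(\<lambda>n. s - 1 / real n) \<longlonglongrightarrow> s - 0" by (intro tendsto_intros lim_1_over_n)
  thus "(\<lambda>n. s - 1 / real n) \<longlonglongrightarrow> s" by simp
qed simp

section \<open>Mixtures of two Cantor measures\<close>

text \<open>A factor between \<open>c\<close> and 1 changes the logarithm by a bounded amount, which
  vanishes after division by \<open>n\<close>.\<close>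

lemma log_ratio_limit:
  assumes "(\<lambda>n. real (S n) / real n) \<longlonglongrightarrow> s" "0 < c"
    and "\<forall>\<^sub>F n in sequentially. c * (1 / 2) ^ S n \<le> m n \<and> m n \<le> (1 / 2) ^ S n"
  shows "(\<lambda>n. - log 2 (m n) / real n) \<longlonglongrightarrow> s"
proof (rule tendsto_sandwich)
  have *: "\<forall>\<^sub>F n in sequentially. real (S n) \<le> - log 2 (m n) \<and> - log 2 (m n) \<le> real (S n) - log 2 c"
    using assms(3)
  proof eventually_elim
    case (elim n)
    have "0 < c * (1 / 2) ^ S n" using \<open>0 < c\<close> by simp
    with elim have "log 2 (c * (1 / 2) ^ S n) \<le> log 2 (m n)" "log 2 (m n) \<le> log 2 ((1 / 2) ^ S n)"
      by (simp_all del: log_le_cancel_iff add: log_le_cancel_iff)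
    thus ?case using \<open>0 < c\<close> by (simp add: log_mult log_nat_power log_divide)
  qed
  show "\<forall>\<^sub>F n in sequentially. real (S n) / real n \<le> - log 2 (m n) / real n"
    using * by eventually_elim (intro divide_right_mono, auto)
  show "\<forall>\<^sub>F n in sequentially. - log 2 (m n) / real n \<le> real (S n) / real n - log 2 c * (1 / real n)"
    using *
  proof eventually_elim
    case (elim n)
    hence "- log 2 (m n) / real n \<le> (real (S n) - log 2 c) / real n"
      by (intro divide_right_mono) auto
    thus ?case by (simp add: diff_divide_distrib)
  qed
  have "(\<lambda>n. real (S n) / real n - log 2 c * (1 / real n)) \<longlonglongrightarrow> s - log 2 c * 0"
    by (intro tendsto_intros assms(1) lim_1_over_n)
  thus "(\<lambda>n. real (S n) / real n - log 2 c * (1 / real n)) \<longlonglongrightarrow> s" by simp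
qed (fact assms(1))

text \<open>The first bound is convexity of \<open>x * ln x\<close>; the second uses that
  \<open>c\<close> dominates both \<open>p * a\<close> and \<open>(1 - p) * b\<close>. Summed over
  dyadic intervals they bound the entropy of a mixture from below and from above.\<close>

lemma convex_comb_ln_bounds:
  fixes a b p :: real
  assumes "0 \<le> a" "0 \<le> b" "0 < p" "p < 1"
  defines "c \<equiv> p * a + (1 - p) * b"
  shows "c * ln c \<le> p * (a * ln a) + (1 - p) * (b * ln b)"
    and "p * (a * ln a) + (1 - p) * (b * ln b) + p * a * ln p + (1 - p) * b * ln (1 - p) \<le> c * ln c"
proof -
  have c0: "0 \<le> c" using assms by simp
  show "c * ln c \<le> p * (a * ln a) + (1 - p) * (b * ln b)"
  proof (cases "c = 0")
    case True
    hence "p * a = 0" "(1 - p) * b = 0"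
      using assms by (auto simp: c_def add_nonneg_eq_0_iff)
    thus ?thesis using assms True by auto
  next
    case False
    hence c: "0 < c" using c0 by simp
    \<comment> \<open>The tangent of \<open>x * ln x\<close> at \<open>c\<close>. Since
      \<open>c\<close> is the weighted mean of \<open>a\<close> and \<open>b\<close>, the terms
      \<open>x - c\<close> cancel in the weighted sum.\<close>
    have tangent: "x * ln c + x - c \<le> x * ln x" if "0 \<le> x" for x
    proof (cases "x = 0")
      case False
      hence x: "0 < x" using that by simp
      have "ln (c / x) \<le> c / x - 1" using x c by (intro ln_le_minus_one) simp
      hence "x * ln (c / x) \<le> x * (c / x - 1)" using x by (intro mult_left_mono) auto
      thus ?thesis using x c by (simp add: ln_div algebra_simps)
    qed (use c in simp)
    have "c * ln c = p * (a * ln c + a - c) + (1 - p) * (b * ln c + b - c)"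
      by (simp add: c_def algebra_simps)
    also have "\<dots> \<le> p * (a * ln a) + (1 - p) * (b * ln b)"
      using assms tangent by (intro add_mono mult_left_mono) auto
    finally show ?thesis .
  qed
  have part: "q * (x * ln x) + q * x * ln q \<le> q * x * ln c" if "0 < q" "0 \<le> x" "q * x \<le> c" for q x
  proof (cases "x = 0")
    case False
    hence "ln (q * x) \<le> ln c" using that by (subst ln_le_cancel_iff) (auto intro: less_le_trans[of 0 "q * x"])
    hence "q * x * ln (q * x) \<le> q * x * ln c" using that by (intro mult_left_mono) auto
    thus ?thesis using that False by (simp add: ln_mult algebra_simps)
  qed simp
  have "p * (a * ln a) + p * a * ln p + ((1 - p) * (b * ln b) + (1 - p) * b * ln (1 - p))
      \<le> p * a * ln c + (1 - p) * b * ln c"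
    using assms by (intro add_mono part) (auto simp: c_def)
  thus "p * (a * ln a) + (1 - p) * (b * ln b) + p * a * ln p + (1 - p) * b * ln (1 - p) \<le> c * ln c"
    by (simp add: c_def algebra_simps)
qed

section \<open>Entropy and local dimensions\<close>

context equidistributed
begin

text \<open>All charged intervals have the same logarithm of mass and the others contribute zero, so
  the entropy is exactly \<open>S n\<close> bits.\<close>

lemma sum_mass_log_mass: "(\<Sum>Q\<in>dyadic_partition n. prob Q * ln (prob Q)) = - real (S n) * ln 2"
proof -
  have "prob Q * ln (prob Q) = - real (S n) * ln 2 * prob Q" if "Q \<in> dyadic_partition n" for Q
    using dyadic_mass[OF that] by (auto simp: ln_realpow ln_div)
  hence "(\<Sum>Q\<in>dyadic_partition n. prob Q * ln (prob Q))
      = - real (S n) * ln 2 * (\<Sum>Q\<in>dyadic_partition n. prob Q)"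
    by (simp add: sum_distrib_left)
  thus ?thesis by (simp add: sum_dyadic_mass)
qed

end

text \<open>Equality \<open>s1 = s2\<close> is allowed; it serves the case
  \<open>D = H\<close>.\<close>

locale cantor_mixture =
  M1: equidistributed \<mu>1 "linear_growth s1" + M2: equidistributed \<mu>2 "linear_growth s2"
  for \<mu>1 \<mu>2 s1 s2 +
  fixes p :: real
  assumes p: "0 < p" "p < 1" and s: "0 < s1" "s1 \<le> s2"
begin

text \<open>A biased coin selects the component from which the point is drawn. Written as a monadic
  bind, the mixture inherits its integration formula from the two-point choice.\<close>

definition mixture :: "real measure" where
  "mixture = measure_pmf (bernoulli_pmf p) \<bind> (\<lambda>b. if b then \<mu>1 else \<mu>2)"

lemma kernel: "(\<lambda>b. if b then \<mu>1 else \<mu>2)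
    \<in> measurable (measure_pmf (bernoulli_pmf p)) (prob_algebra (restrict_space borel {0..1}))"
  by (auto simp: space_prob_algebra M1.sets_eq M2.sets_eq M1.prob_space_axioms M2.prob_space_axioms)

lemma nn_integral_mixture:
  assumes "f \<in> borel_measurable (restrict_space borel {0..1})"
  shows "(\<integral>\<^sup>+x. f x \<partial>mixture) = ennreal p * (\<integral>\<^sup>+x. f x \<partial>\<mu>1) + ennreal (1 - p) * (\<integral>\<^sup>+x. f x \<partial>\<mu>2)"
  unfolding mixture_def
  using p by (subst nn_integral_bind[OF assms measurable_prob_algebraD[OF kernel]])
    (simp add: mult.commute)

sublocale N: unit_interval_prob mixture
proof (intro unit_interval_prob.intro unit_interval_prob_axioms.intro)
  show "prob_space mixture"
    unfolding mixture_def by (rule prob_space_bind'[OF _ kernel]) (simp add: space_prob_algebra measure_pmf.prob_space_axioms)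
  show "sets mixture = sets (restrict_space borel {0..1})"
    unfolding mixture_def by (rule sets_bind'[OF _ kernel]) (simp add: space_prob_algebra measure_pmf.prob_space_axioms)
qed

lemma measure_mixture:
  assumes "X \<in> sets mixture"
  shows "measure mixture X = p * measure \<mu>1 X + (1 - p) * measure \<mu>2 X"
proof -
  have X: "X \<in> sets (restrict_space borel {0..1})" using assms N.sets_eq by simp
  hence "(\<integral>\<^sup>+x. indicator X x \<partial>mixture)
      = ennreal p * (\<integral>\<^sup>+x. indicator X x \<partial>\<mu>1) + ennreal (1 - p) * (\<integral>\<^sup>+x. indicator X x \<partial>\<mu>2)"
    by (intro nn_integral_mixture) simp
  hence "ennreal (measure mixture X) = ennreal (p * measure \<mu>1 X + (1 - p) * measure \<mu>2 X)"
    using X p by (simp add: N.sets_eq M1.sets_eq M2.sets_eq N.emeasure_eq_measure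
      M1.emeasure_eq_measure M2.emeasure_eq_measure ennreal_mult ennreal_plus)
  thus ?thesis using p by (subst (asm) ennreal_inj) auto
qed

lemmas measure_dyadic = measure_mixture[OF N.dyadic_partition_sets]

text \<open>\<open>K\<close> is the mean of the two component entropies. Concavity gives the lower
  bound; the excess is at most the entropy of the coin, which does not depend on
  \<open>n\<close>.\<close>

lemma entropy_bounds:
  fixes n :: nat
  defines "K \<equiv> p * real (linear_growth s1 n) + (1 - p) * real (linear_growth s2 n)"
  shows "K \<le> dyadic_entropy mixture n" "dyadic_entropy mixture n \<le> K - (p * log 2 p + (1 - p) * log 2 (1 - p))"
proof -
  define E where "E = (\<Sum>Q\<in>dyadic_partition n. measure mixture Q * ln (measure mixture Q))"
  have ent: "dyadic_entropy mixture n = - E / ln 2"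
    by (simp add: dyadic_entropy_def E_def log_def sum_divide_distrib)
  have "E \<le> (\<Sum>Q\<in>dyadic_partition n. p * (measure \<mu>1 Q * ln (measure \<mu>1 Q))
      + (1 - p) * (measure \<mu>2 Q * ln (measure \<mu>2 Q)))"
    unfolding E_def using p by (intro sum_mono) (simp add: measure_dyadic convex_comb_ln_bounds(1))
  also have "\<dots> = - K * ln 2"
    by (simp add: sum.distrib flip: sum_distrib_left)
       (simp add: M1.sum_mass_log_mass M2.sum_mass_log_mass K_def algebra_simps)
  finally show "K \<le> dyadic_entropy mixture n" by (simp add: ent field_simps)
  have "(\<Sum>Q\<in>dyadic_partition n. p * (measure \<mu>1 Q * ln (measure \<mu>1 Q))
      + (1 - p) * (measure \<mu>2 Q * ln (measure \<mu>2 Q))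
      + p * measure \<mu>1 Q * ln p + (1 - p) * measure \<mu>2 Q * ln (1 - p)) \<le> E"
    unfolding E_def using p by (intro sum_mono) (simp add: measure_dyadic convex_comb_ln_bounds(2))
  also have "(\<Sum>Q\<in>dyadic_partition n. p * (measure \<mu>1 Q * ln (measure \<mu>1 Q))
      + (1 - p) * (measure \<mu>2 Q * ln (measure \<mu>2 Q))
      + p * measure \<mu>1 Q * ln p + (1 - p) * measure \<mu>2 Q * ln (1 - p))
      = - K * ln 2 + p * ln p + (1 - p) * ln (1 - p)"
    by (simp add: sum.distrib flip: sum_distrib_left sum_distrib_right)
       (simp add: M1.sum_mass_log_mass M2.sum_mass_log_mass M1.sum_dyadic_mass M2.sum_dyadic_mass
         K_def algebra_simps)
  finally show "dyadic_entropy mixture n \<le> K - (p * log 2 p + (1 - p) * log 2 (1 - p))"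
    by (simp add: ent log_def field_simps)
qed

lemma entropy_dimension: "has_entropy_dimension mixture (p * s1 + (1 - p) * s2)"
  unfolding has_entropy_dimension_def
proof (rule tendsto_sandwich)
  let ?K = "\<lambda>n. p * (real (linear_growth s1 n) / real n) + (1 - p) * (real (linear_growth s2 n) / real n)"
  let ?c = "p * log 2 p + (1 - p) * log 2 (1 - p)"
  show K: "?K \<longlonglongrightarrow> p * s1 + (1 - p) * s2"
    using s by (intro tendsto_intros linear_growth_limit) auto
  have "(\<lambda>n. ?K n - ?c * (1 / real n)) \<longlonglongrightarrow> p * s1 + (1 - p) * s2 - ?c * 0"
    by (intro tendsto_diff K tendsto_mult tendsto_const lim_1_over_n)
  thus "(\<lambda>n. ?K n - ?c * (1 / real n)) \<longlonglongrightarrow> p * s1 + (1 - p) * s2" by simp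
  show "\<forall>\<^sub>F n in sequentially. ?K n \<le> dyadic_entropy mixture n / real n"
    using divide_right_mono[OF entropy_bounds(1)] by (intro always_eventually) (simp add: add_divide_distrib)
  show "\<forall>\<^sub>F n in sequentially. dyadic_entropy mixture n / real n \<le> ?K n - ?c * (1 / real n)"
  proof (intro always_eventually allI)
    fix n
    show "dyadic_entropy mixture n / real n \<le> ?K n - ?c * (1 / real n)"
      using divide_right_mono[OF entropy_bounds(2)[of n], of "real n"]
      by (simp add: add_divide_distrib diff_divide_distrib)
  qed
qed

text \<open>Either all intervals around \<open>x\<close> are charged by \<open>\<mu>1\<close>, which
  then dominates up to the factor \<open>p\<close> because its masses decay no faster; or
  \<open>\<mu>1\<close> vanishes on some interval, hence on all smaller ones around
  \<open>x\<close>, and positivity of the mixture forces \<open>\<mu>2\<close> to supply the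
  mass.\<close>

lemma local_dimension: "AE x in mixture. has_dyadic_local_dimension mixture x s1 \<or> has_dyadic_local_dimension mixture x s2"
  using AE_space N.AE_dyadic_mass_pos
proof eventually_elim
  case (elim x)
  hence x: "x \<in> {0..1}" by (simp add: N.space_eq)
  define Q where "Q n = dyadic_containing n x" for n
  have Q: "Q n \<in> dyadic_partition n" for n
    using dyadic_containing_in_partition[OF x] by (simp add: Q_def)
  have pos: "0 < measure mixture (Q n)" for n using elim by (simp add: Q_def)
  have lim: "(\<lambda>n. real (linear_growth s1 n) / real n) \<longlonglongrightarrow> s1"
    "(\<lambda>n. real (linear_growth s2 n) / real n) \<longlonglongrightarrow> s2"
    using s by (auto intro: linear_growth_limit)
  have S: "linear_growth s1 n \<le> linear_growth s2 n" for n
    unfolding linear_growth_def using s by (intro nat_mono floor_mono mult_right_mono) auto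
  show ?case
  proof (cases "\<exists>m. measure \<mu>1 (Q m) = 0")
    case False
    have "p * (1 / 2) ^ linear_growth s1 n \<le> measure mixture (Q n)
        \<and> measure mixture (Q n) \<le> (1 / 2) ^ linear_growth s1 n" for n
    proof -
      have 1: "measure \<mu>1 (Q n) = (1 / 2) ^ linear_growth s1 n"
        using False M1.dyadic_mass[OF Q, of n] by auto
      have "(1 / 2 :: real) ^ linear_growth s2 n \<le> (1 / 2) ^ linear_growth s1 n"
        using S by (intro power_decreasing) auto
      hence 2: "measure \<mu>2 (Q n) \<le> (1 / 2) ^ linear_growth s1 n"
        using M2.dyadic_mass[OF Q, of n] by auto
      have "measure mixture (Q n) \<le> p * (1 / 2) ^ linear_growth s1 n + (1 - p) * (1 / 2) ^ linear_growth s1 n"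
        unfolding measure_dyadic[OF Q] 1 using p 2 by (intro add_mono mult_left_mono) auto
      also have "\<dots> = (1 / 2) ^ linear_growth s1 n" by (simp add: algebra_simps)
      finally show ?thesis using p by (simp add: measure_dyadic[OF Q] 1)
    qed
    hence "has_dyadic_local_dimension mixture x s1"
      unfolding has_dyadic_local_dimension_def Q_def[symmetric]
      by (intro log_ratio_limit[OF lim(1) p(1)] always_eventually) blast
    thus ?thesis ..
  next
    case True
    then obtain m where m: "measure \<mu>1 (Q m) = 0" by blast
    have "(1 - p) * (1 / 2) ^ linear_growth s2 n \<le> measure mixture (Q n)
        \<and> measure mixture (Q n) \<le> (1 / 2) ^ linear_growth s2 n" if "n \<ge> m" for n
    proof -
      have "measure \<mu>1 (Q n) \<le> measure \<mu>1 (Q m)"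
        using dyadic_containing_antimono[OF x that] M1.dyadic_partition_sets[OF Q]
        by (intro M1.finite_measure_mono) (simp_all add: Q_def)
      hence 1: "measure \<mu>1 (Q n) = 0" using m by (simp add: measure_le_0_iff)
      with pos[of n] have "measure \<mu>2 (Q n) \<noteq> 0" by (auto simp: measure_dyadic[OF Q])
      hence 2: "measure \<mu>2 (Q n) = (1 / 2) ^ linear_growth s2 n"
        using M2.dyadic_mass[OF Q, of n] by auto
      show ?thesis using p by (simp add: measure_dyadic[OF Q] 1 2)
    qed
    hence "has_dyadic_local_dimension mixture x s2"
      unfolding has_dyadic_local_dimension_def Q_def[symmetric]
      using p by (intro log_ratio_limit[OF lim(2), of "1 - p"] eventually_sequentiallyI[of m]) auto
    thus ?thesis ..
  qed
qed

end

section \<open>Geometric quantization\<close>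

lemma infdist_measurable [measurable]: "(\<lambda>x. infdist x A) \<in> borel_measurable borel"
  for A :: "real set"
  by (intro borel_measurable_continuous_onI continuous_intros)

lemma ext_ln_infdist_measurable:
  fixes A :: "real set"
  shows "(\<lambda>x. ext_ln (ereal (infdist x A))) \<in> borel_measurable (restrict_space borel {0..1})"
  unfolding ext_ln_def by (intro measurable_restrict_space1) measurable

lemma ext_exp_mono: "x \<le> y \<Longrightarrow> ext_exp x \<le> ext_exp y"
  by (cases x; cases y) (auto simp: ext_exp_def)

lemma ext_ln_nonpos: "0 \<le> d \<Longrightarrow> d \<le> 1 \<Longrightarrow> ext_ln (ereal d) \<le> 0"
  by (auto simp: ext_ln_def)

text \<open>At \<open>d = 0\<close> the right-hand side is infinite, so points that lie in the
  quantizing set need no exception.\<close>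

lemma neg_ext_ln_ge:
  assumes "0 \<le> d" "d \<le> (1 / 2) ^ n"
  shows "ennreal (ln 2 * real n) \<le> e2ennreal (- ext_ln (ereal d))"
proof (cases "d = 0")
  case False
  hence d: "0 < d" using assms by simp
  hence "ln d \<le> ln ((1 / 2) ^ n)" using assms by (subst ln_le_cancel_iff) auto
  hence "ln 2 * real n \<le> - ln d" by (simp add: ln_realpow ln_div algebra_simps)
  thus ?thesis using d by (simp add: ext_ln_def ennreal_leI e2ennreal_ereal)
qed (simp add: ext_ln_def)

text \<open>Layer-cake estimate, also valid for \<open>d = 0\<close>, where both sides are infinite.\<close>

lemma neg_ext_ln_le:
  assumes "0 \<le> d"
  shows "e2ennreal (- ext_ln (ereal d))
    \<le> ennreal (ln 2) * (of_nat m + (\<Sum>j. indicator {y. y < (1 / 2) ^ (m + j)} d))"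
    (is "_ \<le> _ * (of_nat m + ?T)")
proof -
  have T: "of_nat k \<le> ?T" if "\<And>j. j < k \<Longrightarrow> d < (1 / 2) ^ (m + j)" for k
  proof -
    have "(\<Sum>j<k. indicator {y. y < (1 / 2) ^ (m + j)} d :: ennreal) = (\<Sum>j<k. 1)"
      using that by (intro sum.cong) auto
    thus ?thesis using sum_le_suminf[of "\<lambda>j. indicator {y. y < (1 / 2) ^ (m + j)} d :: ennreal" "{..<k}"]
      by simp
  qed
  show ?thesis
  proof (cases "d = 0")
    case True
    \<comment> \<open>At \<open>d = 0\<close> all indicators equal one, so the series exceeds every
      natural number.\<close>
    have "of_nat k \<le> ?T" for k using T True by simp
    hence "?T = top" using ennreal_Ex_less_of_nat[of ?T] less_top leD by blast
    thus ?thesis by (simp add: ennreal_mult_top)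
  next
    case False
    hence d: "0 < d" using assms by simp
    define t where "t = - log 2 d"
    have d_eq: "d = 2 powr (- t)" using d by (simp add: t_def)
    \<comment> \<open>The number of \<open>j\<close> with \<open>m + j < t\<close>, that is, of the
      indicators equal to one; rounding up ensures \<open>t \<le> m + k\<close>.\<close>
    define k where "k = nat \<lceil>t - real m\<rceil>"
    have "d < (1 / 2) ^ (m + j)" if "j < k" for j
    proof -
      have "real (m + j) < t" using that unfolding k_def by linarith
      hence "d < 2 powr (- real (m + j))" unfolding d_eq by simp
      also have "\<dots> = (1 / 2) ^ (m + j)" by (simp only: powr_minus powr_realpow power_one_over inverse_eq_divide)
      finally show ?thesis .
    qed
    from T[OF this] have "ennreal (real m + real k) \<le> of_nat m + ?T"
      by (simp add: ennreal_plus ennreal_of_nat_eq_real_of_nat add_left_mono)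
    moreover have "t \<le> real m + real k" unfolding k_def by linarith
    ultimately have "ennreal t \<le> of_nat m + ?T" by (meson ennreal_leI order_trans)
    hence "ennreal (ln 2) * ennreal t \<le> ennreal (ln 2) * (of_nat m + ?T)" by (rule mult_left_mono) simp
    moreover have "e2ennreal (- ext_ln (ereal d)) = ennreal (ln 2) * ennreal t"
      using d by (simp add: ext_ln_def e2ennreal_ereal t_def log_def flip: ennreal_mult')
    ultimately show ?thesis by simp
  qed
qed

section \<open>Masses of small neighbourhoods and nets of charged intervals\<close>

context equidistributed
begin

text \<open>The ball meets at most the cell of its centre and the two adjacent cells. The centre may
  lie outside \<open>{0..1}\<close>, so cells are indexed by integers here.\<close>

lemma prob_ball_le: "prob {x \<in> space \<mu>. \<bar>x - a\<bar> < (1 / 2) ^ n} \<le> 3 * (1 / 2) ^ S n"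
proof -
  define j where "j = \<lfloor>2 ^ n * a\<rfloor>"
  define I where "I = {k. k < 2 ^ n \<and> int k \<in> {j - 1..j + 1}}"
  have "card I \<le> card {j - 1..j + 1}"
    by (rule card_inj_on_le[of int]) (auto simp: I_def)
  hence card: "card I \<le> 3" by simp
  have fin: "finite I" by (simp add: I_def)
  have "{x \<in> space \<mu>. \<bar>x - a\<bar> < (1 / 2) ^ n} \<subseteq> (\<Union>k\<in>I. dyadic_interval n k)"
  proof safe
    fix x assume x: "x \<in> space \<mu>" "\<bar>x - a\<bar> < (1 / 2) ^ n"
    define k where "k = dyadic_index n x"
    have x': "x \<in> {0..1}" using x by (simp add: space_eq)
    have k: "k < 2 ^ n" "x \<in> dyadic_interval n k"
      using x' mem_dyadic_interval_iff[OF x', of k n] by (auto simp: k_def dyadic_index_less)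
    \<comment> \<open>The upper inequality is weak because the last dyadic interval is closed; the
      strict bound on the distance compensates for this.\<close>
    have "real k \<le> 2 ^ n * x" "2 ^ n * x \<le> real k + 1"
      using k(2) by (auto simp: dyadic_interval_def field_simps split: if_splits)
    moreover have "\<bar>2 ^ n * x - 2 ^ n * a\<bar> < 1"
    proof -
      have "\<bar>2 ^ n * x - 2 ^ n * a\<bar> = 2 ^ n * \<bar>x - a\<bar>"
        by (simp add: abs_mult flip: right_diff_distrib)
      also have "\<dots> < 2 ^ n * (1 / 2) ^ n" using x(2) by (intro mult_strict_left_mono) auto
      finally show ?thesis by (simp add: power_one_over)
    qed
    ultimately have "real k < 2 ^ n * a + 1" "2 ^ n * a < real k + 2" by linarith+
    hence "k \<in> I" using k(1) unfolding I_def j_def by simp linarith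
    with k(2) show "x \<in> (\<Union>k\<in>I. dyadic_interval n k)" by blast
  qed
  hence "prob {x \<in> space \<mu>. \<bar>x - a\<bar> < (1 / 2) ^ n} \<le> prob (\<Union>k\<in>I. dyadic_interval n k)"
    using fin by (intro finite_measure_mono sets.finite_UN) (auto simp: I_def sets_eq dyadic_interval_sets)
  also have "\<dots> \<le> (\<Sum>k\<in>I. prob (dyadic_interval n k))"
    using fin by (intro finite_measure_subadditive_finite) (auto simp: I_def sets_eq dyadic_interval_sets)
  also have "\<dots> \<le> of_nat (card I) * (1 / 2) ^ S n"
  proof (rule sum_bounded_above)
    fix k assume "k \<in> I"
    hence "dyadic_interval n k \<in> dyadic_partition n" by (simp add: I_def dyadic_partition_def)
    from dyadic_mass[OF this] show "prob (dyadic_interval n k) \<le> (1 / 2) ^ S n" by auto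
  qed
  also have "\<dots> \<le> 3 * (1 / 2) ^ S n" using card by (intro mult_right_mono) auto
  finally show ?thesis .
qed

lemma infdist_sets: "{x \<in> space \<mu>. infdist x A < c} \<in> sets \<mu>"
proof -
  have "{x. infdist x A < c} \<in> sets borel" by measurable
  thus ?thesis unfolding sets_eq space_eq by (auto simp: sets_restrict_space Int_def)
qed

text \<open>The distance to a finite set is attained, so the neighbourhood is covered by
  \<open>card A\<close> balls and the union bound applies.\<close>

lemma prob_infdist_le:
  assumes "finite A" "A \<noteq> {}"
  shows "prob {x \<in> space \<mu>. infdist x A < (1 / 2) ^ n} \<le> real (card A) * (3 * (1 / 2) ^ S n)"
proof -
  have meas: "{x \<in> space \<mu>. \<bar>x - a\<bar> < (1 / 2) ^ n} \<in> sets \<mu>" for a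
    using infdist_sets[of "{a}"] by (simp add: dist_real_def)
  have "{x \<in> space \<mu>. infdist x A < (1 / 2) ^ n} \<subseteq> (\<Union>a\<in>A. {x \<in> space \<mu>. \<bar>x - a\<bar> < (1 / 2) ^ n})"
  proof safe
    fix x assume x: "x \<in> space \<mu>" "infdist x A < (1 / 2) ^ n"
    obtain a where "a \<in> A" "infdist x A = dist x a"
      using infdist_attains_inf[of A x] assms finite_imp_closed by auto
    thus "x \<in> (\<Union>a\<in>A. {x \<in> space \<mu>. \<bar>x - a\<bar> < (1 / 2) ^ n})"
      using x by (auto simp: dist_real_def)
  qed
  hence "prob {x \<in> space \<mu>. infdist x A < (1 / 2) ^ n}
      \<le> prob (\<Union>a\<in>A. {x \<in> space \<mu>. \<bar>x - a\<bar> < (1 / 2) ^ n})"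
    using assms meas by (intro finite_measure_mono sets.finite_UN) auto
  also have "\<dots> \<le> (\<Sum>a\<in>A. prob {x \<in> space \<mu>. \<bar>x - a\<bar> < (1 / 2) ^ n})"
    using assms meas by (intro finite_measure_subadditive_finite) auto
  also have "\<dots> \<le> of_nat (card A) * (3 * (1 / 2) ^ S n)"
    by (rule sum_bounded_above) (rule prob_ball_le)
  finally show ?thesis by simp
qed

text \<open>Charged intervals of generation \<open>n\<close> have equal mass and total mass one, so
  there are exactly \<open>2 ^ S n\<close> of them. Their left end points form the net.\<close>

lemma charged_endpoints:
  obtains A where "finite A" "A \<noteq> {}" "A \<subseteq> {0..1}" "card A \<le> 2 ^ S n"
    "AE x in \<mu>. infdist x A \<le> (1 / 2) ^ n"
proof -
  define I where "I = {k. k < 2 ^ n \<and> prob (dyadic_interval n k) \<noteq> 0}"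
  define A where "A = (\<lambda>k. real k / 2 ^ n) ` I"
  have fin: "finite I" by (simp add: I_def)
  have "real (card I) * (1 / 2) ^ S n = (\<Sum>k\<in>I. prob (dyadic_interval n k))"
  proof -
    have "prob (dyadic_interval n k) = (1 / 2) ^ S n" if "k \<in> I" for k
      using dyadic_mass[of "dyadic_interval n k" n] that by (auto simp: I_def dyadic_partition_def)
    thus ?thesis by simp
  qed
  also have "\<dots> = (\<Sum>k<2 ^ n. prob (dyadic_interval n k))"
    by (rule sum.mono_neutral_left) (auto simp: I_def)
  also have "\<dots> = (\<Sum>Q\<in>dyadic_partition n. prob Q)"
    unfolding dyadic_partition_def by (rule sum.reindex_cong[OF inj_on_dyadic_interval, symmetric]) auto
  finally have "real (card I) = 2 ^ S n" by (simp add: sum_dyadic_mass power_one_over field_simps)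
  hence cI: "card I = 2 ^ S n" by (metis of_nat_eq_iff of_nat_numeral of_nat_power)
  show ?thesis
  proof
    show "finite A" using fin by (simp add: A_def)
    have "I \<noteq> {}" using cI by (metis card.empty power_not_zero zero_neq_numeral)
    thus "A \<noteq> {}" by (simp add: A_def)
    show "A \<subseteq> {0..1}"
      using left_endpoint_mem dyadic_interval_subset unfolding A_def I_def by blast
    show "card A \<le> 2 ^ S n" using card_image_le[OF fin] cI by (metis A_def)
    show "AE x in \<mu>. infdist x A \<le> (1 / 2) ^ n"
      using AE_space AE_dyadic_mass_pos
    proof eventually_elim
      case (elim x)
      hence x: "x \<in> {0..1}" by (simp add: space_eq)
      define k where "k = dyadic_index n x"
      have "k \<in> I" using elim(2) dyadic_containing_eq[OF x, of n]
        by (auto simp: I_def k_def dyadic_index_less dest: spec[of _ n])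
      hence "infdist x A \<le> dist x (real k / 2 ^ n)" by (intro infdist_le) (simp add: A_def)
      also have "x \<in> dyadic_interval n k"
        using mem_dyadic_interval_iff[OF x, of k n] by (simp add: k_def dyadic_index_less)
      hence "dist x (real k / 2 ^ n) \<le> (1 / 2) ^ n"
        by (auto simp: dyadic_interval_def dist_real_def add_divide_distrib power_one_over split: if_splits)
      finally show ?case .
    qed
  qed
qed

end

text \<open>The layer-cake estimate is started at a scale \<open>m\<close> that \<open>N\<close>
  points can just resolve, at cost \<open>m\<close>. Beyond it the neighbourhoods of
  \<open>A\<close> have mass at most \<open>6 * r ^ j\<close> with \<open>r = 2 powr (- s)\<close>,
  and the geometric series gives a constant independent of \<open>N\<close>.\<close>

lemma neg_log_integral_le:
  assumes "equidistributed \<mu> (linear_growth s)" "0 < s"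
    and A: "finite A" "A \<noteq> {}" "card A \<le> N"
  shows "(\<integral>\<^sup>+x. e2ennreal (- ext_ln (ereal (infdist x A))) \<partial>\<mu>)
    \<le> ennreal (ln 2 * (log 2 (real N) / s + 1 + 6 / (1 - 2 powr (- s))))"
proof -
  interpret equidistributed \<mu> "linear_growth s" by fact
  have "card A \<noteq> 0" using A by simp
  hence N: "1 \<le> N" using A(3) by linarith
  \<comment> \<open>The least generation with
    \<open>real N * (2 powr (- s)) ^ m \<le> 1\<close>.\<close>
  define m where "m = nat \<lceil>log 2 (real N) / s\<rceil>"
  define r where "r = 2 powr (- s)"
  have "0 < r" "r < 1" using \<open>0 < s\<close> by (simp_all add: r_def powr_less_one)
  have log: "0 \<le> log 2 (real N)" using N by simp
  have m: "log 2 (real N) / s \<le> real m" "real m \<le> log 2 (real N) / s + 1"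
    using log \<open>0 < s\<close> by (auto simp: m_def intro: real_nat_ceiling_ge)
  have Nr: "real N * r ^ m \<le> 1"
  proof -
    have "log 2 (real N) \<le> s * real m" using m(1) \<open>0 < s\<close> by (simp add: field_simps)
    hence "2 powr log 2 (real N) \<le> 2 powr (s * real m)" by simp
    hence "real N \<le> 2 powr (s * real m)" using N by simp
    moreover have *: "r ^ m = inverse (2 powr (s * real m))"
      by (simp add: r_def powr_minus powr_powr power_inverse flip: powr_realpow)
    moreover have "r ^ m > 0" using \<open>0 < r\<close> by simp
    ultimately have "real N * r ^ m \<le> 2 powr (s * real m) * r ^ m" by (intro mult_right_mono) auto
    thus ?thesis using * by simp
  qed
  have prob_le: "prob {x \<in> space \<mu>. infdist x A < (1 / 2) ^ (m + j)} \<le> 6 * r ^ j" for j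
  proof -
    let ?S = "linear_growth s (m + j)"
    have "(1 / 2 :: real) ^ ?S = 2 powr (- real ?S)"
      by (simp only: powr_minus powr_realpow power_one_over inverse_eq_divide)
    \<comment> \<open>The floor in \<open>linear_growth\<close> costs a factor 2, which with the 3
      of the ball estimate makes 6.\<close>
    also have "\<dots> \<le> 2 powr (1 - s * real (m + j))"
      using linear_growth_bounds(2)[of s "m + j"] \<open>0 < s\<close> by simp
    also have "\<dots> = 2 * r ^ (m + j)"
      by (simp add: r_def powr_diff powr_minus powr_powr power_inverse divide_inverse flip: powr_realpow)
    finally have S: "(1 / 2 :: real) ^ ?S \<le> 2 * r ^ (m + j)" .
    have "prob {x \<in> space \<mu>. infdist x A < (1 / 2) ^ (m + j)} \<le> real (card A) * (3 * (1 / 2) ^ ?S)"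
      by (rule prob_infdist_le[OF A(1,2)])
    also have "\<dots> \<le> real N * (3 * (2 * r ^ (m + j)))"
      using A(3) S by (intro mult_mono) auto
    also have "\<dots> = (real N * r ^ m) * (6 * r ^ j)" by (simp add: power_add)
    also have "\<dots> \<le> 1 * (6 * r ^ j)" using Nr \<open>0 < r\<close> by (intro mult_right_mono) auto
    finally show ?thesis by simp
  qed
  have ind: "(indicator {y. y < (1 / 2) ^ (m + j)} (infdist x A) :: ennreal)
      = indicator {x \<in> space \<mu>. infdist x A < (1 / 2) ^ (m + j)} x" if "x \<in> space \<mu>" for x j
    using that by (simp add: indicator_def)
  have "(\<integral>\<^sup>+x. e2ennreal (- ext_ln (ereal (infdist x A))) \<partial>\<mu>)
      \<le> (\<integral>\<^sup>+x. ennreal (ln 2) * (of_nat m +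
          (\<Sum>j. indicator {x \<in> space \<mu>. infdist x A < (1 / 2) ^ (m + j)} x)) \<partial>\<mu>)"
  proof (rule nn_integral_mono)
    fix x assume "x \<in> space \<mu>"
    from neg_ext_ln_le[OF infdist_nonneg, of x A m]
    show "e2ennreal (- ext_ln (ereal (infdist x A))) \<le> ennreal (ln 2) * (of_nat m +
        (\<Sum>j. indicator {x \<in> space \<mu>. infdist x A < (1 / 2) ^ (m + j)} x))"
      unfolding ind[OF \<open>x \<in> space \<mu>\<close>] .
  qed
  also have "\<dots> = ennreal (ln 2) * (of_nat m +
      (\<Sum>j. emeasure \<mu> {x \<in> space \<mu>. infdist x A < (1 / 2) ^ (m + j)}))"
    using infdist_sets by (simp add: nn_integral_cmult nn_integral_add nn_integral_suminf emeasure_space_1)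
  also have "\<dots> \<le> ennreal (ln 2) * (of_nat m + (\<Sum>j. ennreal (6 * r ^ j)))"
    using prob_le by (intro mult_left_mono add_left_mono suminf_le) (auto simp: emeasure_eq_measure intro: ennreal_leI)
  also have "(\<Sum>j. ennreal (6 * r ^ j)) = ennreal (6 / (1 - r))"
  proof (rule suminf_ennreal_eq)
    show "(\<lambda>j. 6 * r ^ j) sums (6 / (1 - r))"
      using sums_mult[OF geometric_sums, of r 6] \<open>0 < r\<close> \<open>r < 1\<close> by simp
  qed (use \<open>0 < r\<close> in simp)
  also have "ennreal (ln 2) * (of_nat m + ennreal (6 / (1 - r))) = ennreal (ln 2 * (real m + 6 / (1 - r)))"
    using \<open>r < 1\<close> by (simp add: ennreal_mult ennreal_plus ennreal_of_nat_eq_real_of_nat)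
  also have "\<dots> \<le> ennreal (ln 2 * (log 2 (real N) / s + 1 + 6 / (1 - r)))"
    using m(2) by (intro ennreal_leI mult_left_mono) auto
  finally show ?thesis by (simp add: r_def)
qed

text \<open>Only half of the \<open>N\<close> points are spent, so that the nets of two components
  fit together. The bound is stated for all finite supersets because it will be applied to the union
  of both nets.\<close>

lemma exists_net:
  assumes "equidistributed \<mu> (linear_growth s)" "0 < s" "2 \<le> N"
  obtains A where "finite A" "A \<noteq> {}" "A \<subseteq> {0..1}" "2 * card A \<le> N"
    "\<And>B. A \<subseteq> B \<Longrightarrow> finite B \<Longrightarrow> ennreal (ln 2 * ((log 2 (real N) - 1) / s - 1))
        \<le> (\<integral>\<^sup>+x. e2ennreal (- ext_ln (ereal (infdist x B))) \<partial>\<mu>)"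
proof -
  interpret equidistributed \<mu> "linear_growth s" by fact
  \<comment> \<open>The largest generation with \<open>s * n \<le> log 2 N - 1\<close>; the
    \<open>- 1\<close> accounts for the halved budget, and rounding down loses the second
    \<open>- 1\<close> of the claim.\<close>
  define n where "n = nat \<lfloor>(log 2 (real N) - 1) / s\<rfloor>"
  have "1 \<le> log 2 (real N)" using assms(3) by (simp add: le_log_iff)
  hence n: "real n \<le> (log 2 (real N) - 1) / s" "(log 2 (real N) - 1) / s < real n + 1"
    using nat_floor_eq_iff[of "(log 2 (real N) - 1) / s" n] \<open>0 < s\<close> by (auto simp: n_def)
  obtain A where A: "finite A" "A \<noteq> {}" "A \<subseteq> {0..1}" "card A \<le> 2 ^ linear_growth s n"
    "AE x in \<mu>. infdist x A \<le> (1 / 2) ^ n"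
    by (rule charged_endpoints)
  show ?thesis
  proof
    have "real (linear_growth s n) \<le> s * real n" using linear_growth_bounds(1) \<open>0 < s\<close> by simp
    also have "\<dots> \<le> log 2 (real N) - 1" using n(1) \<open>0 < s\<close> by (simp add: field_simps)
    finally have "2 powr (real (linear_growth s n) + 1) \<le> 2 powr log 2 (real N)" by simp
    hence "real (2 * 2 ^ linear_growth s n) \<le> real N"
      using assms(3) by (simp add: powr_add powr_realpow)
    hence "2 * 2 ^ linear_growth s n \<le> N" by (simp only: of_nat_le_iff)
    thus "2 * card A \<le> N" using A(4) by linarith
  next
    fix B assume B: "A \<subseteq> B" "finite B"
    have "ennreal (ln 2 * ((log 2 (real N) - 1) / s - 1)) \<le> ennreal (ln 2 * real n)"
      using n(2) by (intro ennreal_leI mult_left_mono) auto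
    also have "\<dots> = (\<integral>\<^sup>+x. ennreal (ln 2 * real n) \<partial>\<mu>)" by (simp add: emeasure_space_1)
    also have "\<dots> \<le> (\<integral>\<^sup>+x. e2ennreal (- ext_ln (ereal (infdist x B))) \<partial>\<mu>)"
      using A(5) by (intro nn_integral_mono_AE) (auto elim!: eventually_mono
        intro!: neg_ext_ln_ge infdist_nonneg intro: order_trans[OF infdist_mono[OF B(1) A(2)]])
    finally show "ennreal (ln 2 * ((log 2 (real N) - 1) / s - 1))
        \<le> (\<integral>\<^sup>+x. e2ennreal (- ext_ln (ereal (infdist x B))) \<partial>\<mu>)" .
  qed (use A in auto)
qed

section \<open>Quantization error of the mixture\<close>

context cantor_mixture
begin

abbreviation neg_log_dist :: "real set \<Rightarrow> real \<Rightarrow> ennreal" where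
  "neg_log_dist A x \<equiv> e2ennreal (- ext_ln (ereal (infdist x A)))"

lemma nn_integral_neg_log_dist:
  "(\<integral>\<^sup>+x. neg_log_dist A x \<partial>mixture)
    = ennreal p * (\<integral>\<^sup>+x. neg_log_dist A x \<partial>\<mu>1) + ennreal (1 - p) * (\<integral>\<^sup>+x. neg_log_dist A x \<partial>\<mu>2)"
  using ext_ln_infdist_measurable[of A] by (intro nn_integral_mixture) measurable

text \<open>The reciprocal of the weighted harmonic mean of \<open>s1\<close> and
  \<open>s2\<close>.\<close>

definition \<kappa> :: real where "\<kappa> = p / s1 + (1 - p) / s2"

lemma \<kappa>_pos: "0 < \<kappa>"
  unfolding \<kappa>_def using p s by (intro add_pos_pos divide_pos_pos) auto

text \<open>All \<open>N\<close> points may be devoted to either component at once, and still each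
  component obeys its own bound; averaging these bounds with the weights gives
  \<open>\<kappa>\<close>.\<close>

lemma quantization_error_ge:
  obtains C where
    "\<And>N. 1 \<le> N \<Longrightarrow> ereal (exp (- (ln 2 * (\<kappa> * log 2 (real N) + C)))) \<le> geom_quantization_error mixture N"
proof
  define C1 where "C1 = 1 + 6 / (1 - 2 powr (- s1))"
  define C2 where "C2 = 1 + 6 / (1 - 2 powr (- s2))"
  define C where "C = p * C1 + (1 - p) * C2"
  fix N :: nat assume N: "1 \<le> N"
  have C: "0 \<le> C1" "0 \<le> C2"
    using s powr_less_one[of 2 "- s1"] powr_less_one[of 2 "- s2"]
    by (auto simp: C1_def C2_def intro!: add_nonneg_nonneg divide_nonneg_nonneg)
  have log: "0 \<le> log 2 (real N)" using N by simp
  show "ereal (exp (- (ln 2 * (\<kappa> * log 2 (real N) + C)))) \<le> geom_quantization_error mixture N"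
    unfolding geom_quantization_error_def
  proof (rule INF_greatest)
    fix A :: "real set" assume "A \<in> {A. finite A \<and> 1 \<le> card A \<and> card A \<le> N}"
    hence A: "finite A" "A \<noteq> {}" "card A \<le> N" by auto
    let ?U1 = "ln 2 * (log 2 (real N) / s1 + C1)" and ?U2 = "ln 2 * (log 2 (real N) / s2 + C2)"
    have U: "0 \<le> ?U1" "0 \<le> ?U2" using C log s by auto
    have "(\<integral>\<^sup>+x. neg_log_dist A x \<partial>mixture) \<le> ennreal p * ennreal ?U1 + ennreal (1 - p) * ennreal ?U2"
      unfolding nn_integral_neg_log_dist
      using neg_log_integral_le[OF M1.equidistributed_axioms _ A]
        neg_log_integral_le[OF M2.equidistributed_axioms _ A] s
      by (intro add_mono mult_left_mono) (auto simp: C1_def C2_def add.assoc)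
    also have "\<dots> = ennreal (p * ?U1 + (1 - p) * ?U2)"
      using p U by (simp only: ennreal_mult[symmetric] ennreal_plus[symmetric])
        (subst ennreal_plus, auto simp: ennreal_mult)
    also have "p * ?U1 + (1 - p) * ?U2 = ln 2 * (\<kappa> * log 2 (real N) + C)"
      using s by (simp add: \<kappa>_def C_def field_simps)
    finally have *: "(\<integral>\<^sup>+x. neg_log_dist A x \<partial>mixture) \<le> ennreal (ln 2 * (\<kappa> * log 2 (real N) + C))" .
    have "0 \<le> ln 2 * (\<kappa> * log 2 (real N) + C)"
      using p C log \<kappa>_pos by (simp add: C_def)
    with * have "enn2ereal (\<integral>\<^sup>+x. neg_log_dist A x \<partial>mixture) \<le> ereal (ln 2 * (\<kappa> * log 2 (real N) + C))"
      by (metis enn2ereal_ennreal less_eq_ennreal.rep_eq)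
    \<comment> \<open>Points of \<open>A\<close> outside \<open>{0..1}\<close> may make the positive
      part of the integral nonzero; dropping it only lowers the integral.\<close>
    hence "0 - ereal (ln 2 * (\<kappa> * log 2 (real N) + C))
        \<le> ext_integral mixture (\<lambda>x. ext_ln (ereal (infdist x A)))"
      unfolding ext_integral_def by (intro ereal_minus_mono) auto
    from ext_exp_mono[OF this]
    show "ereal (exp (- (ln 2 * (\<kappa> * log 2 (real N) + C))))
        \<le> ext_exp (ext_integral mixture (\<lambda>x. ext_ln (ereal (infdist x A))))"
      by (simp add: ext_exp_def)
  qed
qed

text \<open>The competitor is the union of one net for each component, each with at most
  \<open>N / 2\<close> points.\<close>

lemma quantization_error_le:
  obtains C where
    "\<And>N. 2 \<le> N \<Longrightarrow> geom_quantization_error mixture N \<le> ereal (exp (- (ln 2 * (\<kappa> * log 2 (real N) - C))))"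
proof
  \<comment> \<open>The share \<open>\<kappa>\<close> comes from halving the budget, the share 1
    from rounding the generation down.\<close>
  define C where "C = \<kappa> + 1"
  fix N :: nat assume N: "2 \<le> N"
  let ?L1 = "ln 2 * ((log 2 (real N) - 1) / s1 - 1)" and ?L2 = "ln 2 * ((log 2 (real N) - 1) / s2 - 1)"
  obtain A1 where A1: "finite A1" "A1 \<noteq> {}" "A1 \<subseteq> {0..1}" "2 * card A1 \<le> N"
    "\<And>B. A1 \<subseteq> B \<Longrightarrow> finite B \<Longrightarrow> ennreal ?L1 \<le> (\<integral>\<^sup>+x. neg_log_dist B x \<partial>\<mu>1)"
    by (rule exists_net[OF M1.equidistributed_axioms _ N]) (use s in auto)
  obtain A2 where A2: "finite A2" "A2 \<noteq> {}" "A2 \<subseteq> {0..1}" "2 * card A2 \<le> N"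
    "\<And>B. A2 \<subseteq> B \<Longrightarrow> finite B \<Longrightarrow> ennreal ?L2 \<le> (\<integral>\<^sup>+x. neg_log_dist B x \<partial>\<mu>2)"
    by (rule exists_net[OF M2.equidistributed_axioms _ N]) (use s in auto)
  define A where "A = A1 \<union> A2"
  have fin: "finite A" and ne: "A \<noteq> {}" and sub: "A \<subseteq> {0..1}" using A1 A2 by (auto simp: A_def)
  have "card A \<le> card A1 + card A2" unfolding A_def by (rule card_Un_le)
  hence card: "card A \<le> N" using A1(4) A2(4) by linarith
  \<comment> \<open>Both nets lie in \<open>{0..1}\<close>, so the logarithm is nonpositive there
    and the positive part of the integral vanishes.\<close>
  have "infdist x A \<le> 1" if "x \<in> {0..1}" for x
  proof -
    obtain a where "a \<in> A" using ne by blast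
    hence "infdist x A \<le> dist x a" by (rule infdist_le)
    moreover have "a \<in> {0..1}" using \<open>a \<in> A\<close> sub by blast
    ultimately show ?thesis using that by (auto simp: dist_real_def)
  qed
  hence "(\<integral>\<^sup>+x. e2ennreal (ext_ln (ereal (infdist x A))) \<partial>mixture) = (\<integral>\<^sup>+x. 0 \<partial>mixture)"
    by (intro nn_integral_cong e2ennreal_neg ext_ln_nonpos infdist_nonneg) (auto simp: N.space_eq)
  hence pos: "(\<integral>\<^sup>+x. e2ennreal (ext_ln (ereal (infdist x A))) \<partial>mixture) = 0" by simp
  have "ennreal (ln 2 * (\<kappa> * log 2 (real N) - C)) = ennreal (p * ?L1 + (1 - p) * ?L2)"
    using s unfolding \<kappa>_def C_def
    by (intro arg_cong[of _ _ ennreal]) (simp add: divide_simps, simp add: algebra_simps)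
  \<comment> \<open>\<open>ennreal\<close> sends negative reals to zero and is additive only on
    nonnegative ones, and \<open>?L1\<close> and \<open>?L2\<close> can be negative for small
    \<open>N\<close>.\<close>
  also have "\<dots> \<le> ennreal (p * max 0 ?L1 + (1 - p) * max 0 ?L2)"
    using p by (intro ennreal_leI add_mono mult_left_mono) auto
  also have "\<dots> = ennreal p * ennreal (max 0 ?L1) + ennreal (1 - p) * ennreal (max 0 ?L2)"
    using p by (subst ennreal_plus) (auto simp: ennreal_mult)
  also have "\<dots> = ennreal p * ennreal ?L1 + ennreal (1 - p) * ennreal ?L2"
    by (simp only: ennreal_max_0)
  also have "\<dots> \<le> (\<integral>\<^sup>+x. neg_log_dist A x \<partial>mixture)"
    unfolding nn_integral_neg_log_dist
    using fin by (intro add_mono mult_left_mono A1(5) A2(5)) (auto simp: A_def)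
  finally have "enn2ereal (ennreal (ln 2 * (\<kappa> * log 2 (real N) - C))) \<le> enn2ereal (\<integral>\<^sup>+x. neg_log_dist A x \<partial>mixture)"
    by (simp add: less_eq_ennreal.rep_eq)
  moreover have "ereal (ln 2 * (\<kappa> * log 2 (real N) - C)) \<le> enn2ereal (ennreal (ln 2 * (\<kappa> * log 2 (real N) - C)))"
    by (cases "0 \<le> ln 2 * (\<kappa> * log 2 (real N) - C)")
       (auto simp: enn2ereal_ennreal intro: order_trans[OF _ enn2ereal_nonneg])
  ultimately have "ext_integral mixture (\<lambda>x. ext_ln (ereal (infdist x A))) \<le> 0 - ereal (ln 2 * (\<kappa> * log 2 (real N) - C))"
    unfolding ext_integral_def pos by (intro ereal_minus_mono) (auto simp: zero_ennreal.rep_eq)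
  from ext_exp_mono[OF this]
  have "ext_exp (ext_integral mixture (\<lambda>x. ext_ln (ereal (infdist x A))))
      \<le> ereal (exp (- (ln 2 * (\<kappa> * log 2 (real N) - C))))"
    by (simp add: ext_exp_def)
  moreover have "1 \<le> card A" using fin ne by (simp add: Suc_leI card_gt_0_iff)
  ultimately show "geom_quantization_error mixture N \<le> ereal (exp (- (ln 2 * (\<kappa> * log 2 (real N) - C))))"
    unfolding geom_quantization_error_def using fin card by (intro INF_lower2[of A]) auto
qed

lemma quantization_dimension: "has_geom_quantization_dimension mixture (1 / \<kappa>)"
proof -
  obtain C where C: "\<And>N. 1 \<le> N \<Longrightarrow>
      ereal (exp (- (ln 2 * (\<kappa> * log 2 (real N) + C)))) \<le> geom_quantization_error mixture N"
    by (rule quantization_error_ge) blast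
  obtain C' where C': "\<And>N. 2 \<le> N \<Longrightarrow>
      geom_quantization_error mixture N \<le> ereal (exp (- (ln 2 * (\<kappa> * log 2 (real N) - C'))))"
    by (rule quantization_error_le) blast
  \<comment> \<open>For \<open>2 \<le> N\<close> the error lies between two positive reals, so
    passing to \<open>real_of_ereal\<close> and the real logarithm loses nothing.\<close>
  define t where "t N = - ln (real_of_ereal (geom_quantization_error mixture N)) / ln 2" for N
  have t: "- ext_log2 (geom_quantization_error mixture N) = ereal (t N)"
    "\<kappa> * log 2 (real N) - C' \<le> t N" "t N \<le> \<kappa> * log 2 (real N) + C" if N: "2 \<le> N" for N
  proof -
    have lo: "ereal (exp (- (ln 2 * (\<kappa> * log 2 (real N) + C)))) \<le> geom_quantization_error mixture N"
      using C N by simp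
    obtain e where e: "geom_quantization_error mixture N = ereal e"
      using lo C'[OF N] by (cases "geom_quantization_error mixture N") auto
    have e1: "exp (- (ln 2 * (\<kappa> * log 2 (real N) + C))) \<le> e"
      "e \<le> exp (- (ln 2 * (\<kappa> * log 2 (real N) - C')))"
      using lo C'[OF N] by (simp_all add: e)
    have "0 < e" using e1(1) by (rule less_le_trans[OF exp_gt_zero])
    hence "- (ln 2 * (\<kappa> * log 2 (real N) + C)) \<le> ln e" "ln e \<le> - (ln 2 * (\<kappa> * log 2 (real N) - C'))"
      using e1 \<open>0 < e\<close> by (simp_all add: ln_ge_iff) (metis ln_exp ln_le_cancel_iff exp_gt_zero)
    thus "\<kappa> * log 2 (real N) - C' \<le> t N" "t N \<le> \<kappa> * log 2 (real N) + C"
      unfolding t_def e by (simp_all add: field_simps)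
    show "- ext_log2 (geom_quantization_error mixture N) = ereal (t N)"
      using \<open>0 < e\<close> by (simp add: e ext_log2_def ext_ln_def t_def)
  qed
  have log_lim: "filterlim (\<lambda>N. log 2 (real N)) at_top sequentially" by real_asymp
  have inv_lim: "(\<lambda>N. 1 / log 2 (real N)) \<longlonglongrightarrow> 0" by real_asymp
  have log_pos: "\<forall>\<^sub>F N in sequentially. 2 \<le> N \<and> 0 < log 2 (real N)"
    using eventually_ge_at_top[of 2] by eventually_elim simp
  have ratio: "(\<lambda>N. t N / log 2 (real N)) \<longlonglongrightarrow> \<kappa>"
  proof (rule tendsto_sandwich)
    show "\<forall>\<^sub>F N in sequentially. \<kappa> - C' * (1 / log 2 (real N)) \<le> t N / log 2 (real N)"
      using log_pos
    proof eventually_elim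
      case (elim N)
      hence "(\<kappa> * log 2 (real N) - C') / log 2 (real N) \<le> t N / log 2 (real N)"
        using t(2)[of N] by (intro divide_right_mono) auto
      thus ?case using elim by (simp add: diff_divide_distrib)
    qed
    show "\<forall>\<^sub>F N in sequentially. t N / log 2 (real N) \<le> \<kappa> + C * (1 / log 2 (real N))"
      using log_pos
    proof eventually_elim
      case (elim N)
      hence "t N / log 2 (real N) \<le> (\<kappa> * log 2 (real N) + C) / log 2 (real N)"
        using t(3)[of N] by (intro divide_right_mono) auto
      thus ?case using elim by (simp add: add_divide_distrib)
    qed
    have "(\<lambda>N. \<kappa> - C' * (1 / log 2 (real N))) \<longlonglongrightarrow> \<kappa> - C' * 0" by (intro tendsto_intros inv_lim)
    thus "(\<lambda>N. \<kappa> - C' * (1 / log 2 (real N))) \<longlonglongrightarrow> \<kappa>" by simp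
    have "(\<lambda>N. \<kappa> + C * (1 / log 2 (real N))) \<longlonglongrightarrow> \<kappa> + C * 0" by (intro tendsto_intros inv_lim)
    thus "(\<lambda>N. \<kappa> + C * (1 / log 2 (real N))) \<longlonglongrightarrow> \<kappa>" by simp
  qed
  have "(\<lambda>N. 1 / (t N / log 2 (real N))) \<longlonglongrightarrow> 1 / \<kappa>"
    using \<kappa>_pos by (intro tendsto_divide ratio tendsto_const) simp
  hence lim: "(\<lambda>N. ereal (log 2 (real N) / t N)) \<longlonglongrightarrow> ereal (1 / \<kappa>)" by simp
  \<comment> \<open>Eventually \<open>t N\<close> is nonzero, so that extended division agrees with
    real division.\<close>
  have "\<forall>\<^sub>F N in sequentially. 0 < t N / log 2 (real N)"
    using order_tendstoD(1)[OF ratio \<kappa>_pos] .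
  hence "\<forall>\<^sub>F N in sequentially. ereal (log 2 (real N) / t N)
      = ereal (log 2 (real N)) / (- ext_log2 (geom_quantization_error mixture N))"
    using log_pos
  proof eventually_elim
    case (elim N)
    hence "t N \<noteq> 0" by auto
    thus ?case using elim t(1)[of N] by simp
  qed
  with lim show ?thesis
    unfolding has_geom_quantization_dimension_def by (rule Lim_transform_eventually)
qed

end

section \<open>Realisation\<close>

text \<open>An intermediate value argument along a path of pairs with fixed weights and fixed mean
  \<open>H\<close>, from \<open>(H, H)\<close> with harmonic mean \<open>H\<close> to
  \<open>(a, b)\<close> with harmonic mean \<open>a * b / (a + b - H)\<close>.\<close>

lemma exists_two_point_distribution:
  fixes a b H D :: real
  assumes "0 < a" "a < b" "a \<le> H" "H \<le> b" "a * b / (a + b - H) \<le> D" "D \<le> H"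
  obtains p s1 s2 where "0 < p" "p < 1" "a \<le> s1" "s1 \<le> s2" "s2 \<le> b"
    "p * s1 + (1 - p) * s2 = H" "1 / (p / s1 + (1 - p) / s2) = D"
proof (cases "D = H")
  case True
  show ?thesis
    by (rule that[of "1 / 2" H H]) (use assms True in auto)
next
  case False
  hence "D < H" using assms by simp
  \<comment> \<open>At either end point the lower bound for \<open>D\<close> equals
    \<open>H\<close>, contradicting \<open>D < H\<close>.\<close>
  have "H \<noteq> a" "H \<noteq> b" using assms \<open>D < H\<close> by auto
  hence H: "a < H" "H < b" using assms by auto
  \<comment> \<open>The weight for which \<open>p * a + (1 - p) * b = H\<close>.\<close>
  define p where "p = (b - H) / (b - a)"
  have p: "0 < p" "p < 1" using H by (simp_all add: p_def)
  define f where "f t = H - t * (H - a)" for t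
  define g where "g t = H + t * (b - H)" for t
  define h where "h t = 1 / (p / f t + (1 - p) / g t)" for t
  have f: "a \<le> f t" "f t \<le> H" if "0 \<le> t" "t \<le> 1" for t
  proof -
    have "t * (H - a) \<le> 1 * (H - a)" "0 \<le> t * (H - a)" using that H by (intro mult_right_mono mult_nonneg_nonneg; simp)+
    thus "a \<le> f t" "f t \<le> H" by (simp_all add: f_def)
  qed
  have g: "H \<le> g t" "g t \<le> b" if "0 \<le> t" "t \<le> 1" for t
  proof -
    have "t * (b - H) \<le> 1 * (b - H)" "0 \<le> t * (b - H)" using that H by (intro mult_right_mono mult_nonneg_nonneg; simp)+
    thus "H \<le> g t" "g t \<le> b" by (simp_all add: g_def)
  qed
  have pos: "0 < p / f t + (1 - p) / g t" if "0 \<le> t" "t \<le> 1" for t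
    using f[OF that] g[OF that] p assms(1) H by (intro add_pos_pos divide_pos_pos) auto
  have "continuous_on {0..1} h"
    unfolding h_def
  proof (intro continuous_intros)
    show "continuous_on {0..1} f" "continuous_on {0..1} g"
      unfolding f_def g_def by (intro continuous_intros)+
  qed (use f g pos assms(1) H in \<open>force+\<close>)
  moreover have "h 1 \<le> D"
  proof -
    have "p / a + (1 - p) / b = (a + b - H) / (a * b)"
      using H assms(1,2) unfolding p_def by (simp add: divide_simps) (simp add: algebra_simps)
    hence "h 1 = a * b / (a + b - H)" by (simp add: h_def f_def g_def)
    thus ?thesis using assms(5) by simp
  qed
  moreover have "D \<le> h 0"
    using assms(1,6) H by (simp add: h_def f_def g_def flip: add_divide_distrib)
  ultimately obtain t where t: "0 \<le> t" "t \<le> 1" "h t = D"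
    using IVT2'[of h 1 D 0] by auto
  show ?thesis
  proof (rule that[OF p, of "f t" "g t"])
    show "a \<le> f t" "f t \<le> g t" "g t \<le> b" using f[OF t(1,2)] g[OF t(1,2)] by auto
    have "p * (b - a) = b - H" using assms(2) by (simp add: p_def)
    hence "p * (H - a) = (1 - p) * (b - H)" by (simp add: algebra_simps)
    thus "p * f t + (1 - p) * g t = H" unfolding f_def g_def by algebra
    show "1 / (p / f t + (1 - p) / g t) = D" using t(3) by (simp add: h_def)
  qed
qed

theorem mainTheorem12:
  fixes s_minus s_plus H D :: real
  assumes "0 < s_minus" and "s_minus < s_plus" and "s_plus \<le> 1"
    and "s_minus \<le> H" and "H \<le> s_plus"
    and "s_minus * s_plus / (s_minus + s_plus - H) \<le> D" and "D \<le> H"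
  shows "\<exists>\<nu> :: real measure.
           prob_space \<nu> \<and> sets \<nu> = sets (restrict_space borel {0..1}) \<and>
           (AE x in \<nu>. \<exists>s\<in>{s_minus..s_plus}. has_dyadic_local_dimension \<nu> x s) \<and>
           has_entropy_dimension \<nu> H \<and>
           has_geom_quantization_dimension \<nu> D"
proof -
  obtain p s1 s2 where p: "0 < p" "p < 1" and bounds: "s_minus \<le> s1" "s1 \<le> s2" "s2 \<le> s_plus"
    and H: "p * s1 + (1 - p) * s2 = H" and D: "1 / (p / s1 + (1 - p) / s2) = D"
    using exists_two_point_distribution[OF assms(1,2,4-7)] by metis
  obtain \<mu>1 where "equidistributed \<mu>1 (linear_growth s1)"
    using digit_positions.exists_equidistributed[OF digit_positions_linear_growth[of s1]] bounds assms by auto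
  moreover obtain \<mu>2 where "equidistributed \<mu>2 (linear_growth s2)"
    using digit_positions.exists_equidistributed[OF digit_positions_linear_growth[of s2]] bounds assms by auto
  ultimately interpret cantor_mixture \<mu>1 \<mu>2 s1 s2 p
    using p bounds assms by (intro cantor_mixture.intro cantor_mixture_axioms.intro) auto
  show ?thesis
  proof (intro exI[of _ mixture] conjI)
    show "AE x in mixture. \<exists>s\<in>{s_minus..s_plus}. has_dyadic_local_dimension mixture x s"
      using local_dimension by eventually_elim (use bounds in auto)
    show "has_entropy_dimension mixture H" using entropy_dimension by (simp add: H)
    show "has_geom_quantization_dimension mixture D" using quantization_dimension by (simp add: \<kappa>_def D)
  qed (fact N.prob_space_axioms N.sets_eq)+
qed

end
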